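(* Consider the adaptivity gap between one-sided static and one-sided adaptive policies, $\sup_I \mathrm{OPT}_{OA}(I)/\mathrm{OPT}_{OS}(I)$, over cardinality-constrained instances $I$ with $\mathrm{OPT}_{OS}(I)>0$. (a) Under the two-way constrained setting, the gap lies between $e/(e-1)$ and $(e/(e-1))^2$. (b) Under the two-way constrained setting, when all customers and suppliers follow multinomial-logit (MNL) choice models, the upper bound improves to $e/(e-1)$; that is, $\mathrm{OPT}_{OA}(I)\le \frac{e}{e-1}\mathrm{OPT}_{OS}(I)$ for every such instance. (c) Under the one-way constrained setting, the gap is exactly $e/(e-1)$.
   Context: Instance $I$: finite disjoint nonempty sets $\mathcal C$ (customers) and $\mathcal S$ (suppliers); agents $\mathcal A=\mathcal C\cup\mathcal S$; budgets $K_a$ for agents. For $a\in\mathcal A$ let $N_a$ be the opposite side. Each agent $a$ has a choice model $\phi_a:(N_a\cup\{0\})\times 2^{N_a}\to[0,1]$ ($0$ is the outside option) with $\sum_{b\in B\cup\{0\}}\phi_a(b,B)=1$ and $\phi_a(b,B)=0$ for $b\notin B\cup\{0\}$. Unconstrained demand function: $f_a(B)=\sum_{b\in B}\phi_a(b,B)$ for $B\subseteq N_a$. Standing assumption: every $f_a$ is a monotone submodular set function. An MNL choice model has the form $\phi_a(b,B)=u_{ab}/(1+\sum_{c\in B}u_{ac})$, $b\in B$, with weights $u_{ab}\ge0$. Policy: proceeds in steps; in each step, based on all choices observed so far (and possibly its own randomness), it selects a set of not-yet-processed agents and shows each selected agent $a$ an assortment $B_a\subseteq N_a$ satisfying the applicable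 cardinality constraint; each selected agent independently and irrevocably chooses $b\in B_a\cup\{0\}$ with probability $\phi_a(b,B_a)$, and these choices are observed. It stops when every agent has been processed exactly once. A customer and supplier match if they choose each other; $\mathsf M_\pi$ is the number of matches. One-sided static policies: process all agents of one side (the initiating side, fixed in advance, either customers or suppliers) simultaneously, observe their choices, then process all agents of the other (responding) side. One-sided adaptive policies: process all agents of the initiating side one by one (observing each choice before the next; order and assortments may be adaptive), then all agents of the responding side. $\mathrm{OPT}_{OS}(I)$, $\mathrm{OPT}_{OA}(I)$ are the maxima of $\mathbb E[\mathsf M_\pi]$ over the respective classes (over both choices of initiating side). Two-way constrained setting: $K_a$ is an arbitrary positive integer for every $a\in\mathcal A$ and every assortment must satisfy $|B_a|\le K_a$. One-way constrained setting: the constraint $|B_a|\le K_a$ (arbitrary positive integers) is imposed only on agents $a$ of the initiating side, with no constraint on the responding side ($K_a=+\infty$).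
   Formalization: In (a) and (c) the choice models are also assumed regular (enlarging an assortment never raises the choice probability of an option in it, as in all random-utility models); without this the upper bounds fail, since submodular demand limits only the total choice probability. *)

theory Defs
  imports "HOL-Probability.Probability" "HOL-Library.Infinite_Typeclass"
begin

section \<open>Instances\<close>

text \<open>
  A choice model is a kernel into \<^typ>\<open>'a option pmf\<close>: the value \<^term>\<open>None\<close> is the outside
  option 0, and \<open>pmf (Choice I a B) (Some b)\<close> is the probability that \<open>a\<close> chooses \<open>b\<close> from \<open>B\<close>.
  Nonnegativity and total mass 1 are built into the type.
\<close>

record 'a market =
  Customers :: "'a set"
  Suppliers :: "'a set"
  Budget :: "'a \<Rightarrow> nat"
  Choice :: "'a \<Rightarrow> 'a set \<Rightarrow> 'a option pmf"

definition agents :: "'a market \<Rightarrow> 'a set" where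
  "agents I = Customers I \<union> Suppliers I"

definition opposite :: "'a market \<Rightarrow> 'a \<Rightarrow> 'a set" where
  "opposite I a = (if a \<in> Customers I then Suppliers I else Customers I)"

definition choice_prob :: "'a market \<Rightarrow> 'a \<Rightarrow> 'a \<Rightarrow> 'a set \<Rightarrow> real" where
  "choice_prob I a b B = pmf (Choice I a B) (Some b)"

definition demand :: "'a market \<Rightarrow> 'a \<Rightarrow> 'a set \<Rightarrow> real" where
  "demand I a B = (\<Sum>b\<in>B. choice_prob I a b B)"

definition submodular_on :: "'a set \<Rightarrow> ('a set \<Rightarrow> real) \<Rightarrow> bool" where
  "submodular_on N f \<longleftrightarrow> (\<forall>X\<subseteq>N. \<forall>Y\<subseteq>N. f (X \<union> Y) + f (X \<inter> Y) \<le> f X + f Y)"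

definition valid_market :: "'a market \<Rightarrow> bool" where
  "valid_market I \<longleftrightarrow>
     finite (Customers I) \<and> Customers I \<noteq> {} \<and>
     finite (Suppliers I) \<and> Suppliers I \<noteq> {} \<and>
     Customers I \<inter> Suppliers I = {} \<and>
     (\<forall>a\<in>agents I. Budget I a > 0) \<and>
     (\<forall>a\<in>agents I. \<forall>B\<subseteq>opposite I a. set_pmf (Choice I a B) \<subseteq> insert None (Some ` B)) \<and>
     (\<forall>a\<in>agents I. mono_on (Pow (opposite I a)) (demand I a) \<and>
                     submodular_on (opposite I a) (demand I a))"

text \<open>
  Regularity (weak rationality, substitutability): enlarging an assortment does not make an
  alternative already in it more likely to be chosen. This is not a consequence of monotonicity and
  submodularity of the demand function, which constrain only the total probability of choosing
  somebody. It is what makes it optimal to offer to a responding agent only agents that chose it.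
\<close>

definition regular :: "'a market \<Rightarrow> bool" where
  "regular I \<longleftrightarrow>
     (\<forall>a\<in>agents I. \<forall>B B'. B \<subseteq> B' \<and> B' \<subseteq> opposite I a \<longrightarrow>
        (\<forall>b\<in>B. choice_prob I a b B' \<le> choice_prob I a b B))"

definition mnl :: "'a market \<Rightarrow> bool" where
  "mnl I \<longleftrightarrow>
     (\<forall>a\<in>agents I. \<exists>u :: 'a \<Rightarrow> real.
        (\<forall>b\<in>opposite I a. u b \<ge> 0) \<and>
        (\<forall>B\<subseteq>opposite I a. \<forall>b\<in>B. choice_prob I a b B = u b / (1 + (\<Sum>c\<in>B. u c))))"


section \<open>Policies\<close>

text \<open>
  The action of a step is a partial map: its domain is the set of selected agents, its values are
  the assortments shown. The observation of a step is the function of choices made, with the value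
  \<^term>\<open>None\<close> for the selected agents that took the outside option (and for those not selected).
  A policy maps what has happened so far to a distribution over actions; as past actions are part
  of the history, this covers every use of private randomness.
\<close>

type_synonym 'a action = "'a \<rightharpoonup> 'a set"
type_synonym 'a history = "('a action \<times> ('a \<Rightarrow> 'a option)) list"
type_synonym 'a policy = "'a history \<Rightarrow> 'a action pmf"

definition processed :: "'a history \<Rightarrow> 'a set" where
  "processed h = (\<Union>(x, ch)\<in>set h. dom x)"

definition chose :: "'a history \<Rightarrow> 'a \<Rightarrow> 'a \<Rightarrow> bool" where
  "chose h a b \<longleftrightarrow> (\<exists>(x, ch)\<in>set h. a \<in> dom x \<and> ch a = Some b)"

definition num_matches :: "'a market \<Rightarrow> 'a history \<Rightarrow> nat" where
  "num_matches I h =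
     card {(c, s). c \<in> Customers I \<and> s \<in> Suppliers I \<and> chose h c s \<and> chose h s c}"

definition choices :: "'a market \<Rightarrow> 'a action \<Rightarrow> ('a \<Rightarrow> 'a option) pmf" where
  "choices I x = Pi_pmf (dom x) None (\<lambda>a. Choice I a (the (x a)))"

definition policy_step :: "'a market \<Rightarrow> 'a policy \<Rightarrow> 'a history \<Rightarrow> 'a history pmf" where
  "policy_step I \<pi> h =
     (if agents I \<subseteq> processed h then return_pmf h
      else bind_pmf (\<pi> h) (\<lambda>x. map_pmf (\<lambda>ch. h @ [(x, ch)]) (choices I x)))"

primrec run :: "'a market \<Rightarrow> 'a policy \<Rightarrow> nat \<Rightarrow> 'a history pmf" where
  "run I \<pi> 0 = return_pmf []"
| "run I \<pi> (Suc n) = bind_pmf (run I \<pi> n) (policy_step I \<pi>)"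

text \<open>
  Every step selects at least one new agent, so an admissible policy has stopped after
  \<open>card (agents I)\<close> steps.
\<close>

definition expected_matches :: "'a market \<Rightarrow> 'a policy \<Rightarrow> real" where
  "expected_matches I \<pi> =
     measure_pmf.expectation (run I \<pi> (card (agents I))) (\<lambda>h. real (num_matches I h))"

definition possible :: "'a market \<Rightarrow> 'a policy \<Rightarrow> 'a history \<Rightarrow> 'a action \<Rightarrow> bool" where
  "possible I \<pi> h x \<longleftrightarrow>
     (\<exists>n. h \<in> set_pmf (run I \<pi> n)) \<and> \<not> agents I \<subseteq> processed h \<and> x \<in> set_pmf (\<pi> h)"

definition admissible :: "'a market \<Rightarrow> ('a \<Rightarrow> enat) \<Rightarrow> 'a policy \<Rightarrow> bool" where
  "admissible I cap \<pi> \<longleftrightarrow>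
     (\<forall>h x. possible I \<pi> h x \<longrightarrow>
        dom x \<noteq> {} \<and> dom x \<subseteq> agents I - processed h \<and>
        (\<forall>a\<in>dom x. the (x a) \<subseteq> opposite I a \<and> enat (card (the (x a))) \<le> cap a))"

text \<open>
  \<open>D\<close> is the initiating side. Once it has been processed, admissibility leaves only agents of the
  other side to be selected. How these are grouped into steps is left open; a responding agent's
  matches depend only on the initiating side's choices and on its own.
\<close>

definition one_sided_static :: "'a market \<Rightarrow> 'a set \<Rightarrow> 'a policy \<Rightarrow> bool" where
  "one_sided_static I D \<pi> \<longleftrightarrow> (\<forall>x. possible I \<pi> [] x \<longrightarrow> dom x = D)"

definition one_sided_adaptive :: "'a market \<Rightarrow> 'a set \<Rightarrow> 'a policy \<Rightarrow> bool" where
  "one_sided_adaptive I D \<pi> \<longleftrightarrow>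
     (\<forall>h x. possible I \<pi> h x \<and> \<not> D \<subseteq> processed h \<longrightarrow> (\<exists>a\<in>D. dom x = {a}))"


section \<open>Optimal values and the adaptivity gap\<close>

datatype setting = Two_Way | One_Way

primrec cap :: "setting \<Rightarrow> 'a market \<Rightarrow> 'a set \<Rightarrow> 'a \<Rightarrow> enat" where
  "cap Two_Way I D a = enat (Budget I a)"
| "cap One_Way I D a = (if a \<in> D then enat (Budget I a) else \<infinity>)"

text \<open>
  The suprema below are over nonempty sets of reals bounded by the number of customer-supplier
  pairs; they are attained, by deterministic policies.
\<close>

definition OPT_OS :: "setting \<Rightarrow> 'a market \<Rightarrow> real" where
  "OPT_OS w I =
     Sup {expected_matches I \<pi> | \<pi> D. D \<in> {Customers I, Suppliers I} \<and>
            admissible I (cap w I D) \<pi> \<and> one_sided_static I D \<pi>}"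

definition OPT_OA :: "setting \<Rightarrow> 'a market \<Rightarrow> real" where
  "OPT_OA w I =
     Sup {expected_matches I \<pi> | \<pi> D. D \<in> {Customers I, Suppliers I} \<and>
            admissible I (cap w I D) \<pi> \<and> one_sided_adaptive I D \<pi>}"

definition adaptivity_gap :: "setting \<Rightarrow> 'a market set \<Rightarrow> ereal" where
  "adaptivity_gap w \<I> = (SUP I \<in> {I \<in> \<I>. OPT_OS w I > 0}. ereal (OPT_OA w I / OPT_OS w I))"

end

theory Submission
  imports Defs "HOL-Real_Asymp.Real_Asymp"
begin

text \<open>
  Fix the initiating side \<open>D\<close> and the responding side \<open>R\<close>. Once \<open>D\<close> has been processed, a responding
  agent \<open>j\<close> has a backlog \<open>C\<close>, the set of initiating agents that chose it. By regularity its best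
  offer is a set \<open>B \<subseteq> C\<close> of admissible size that maximizes its demand; let \<open>g\<^sub>j C\<close> be this maximum. The
  value of a one-sided policy is therefore at most the expectation of the sum of \<open>g\<^sub>j\<close> over the
  backlogs, and equal to it if the policy responds optimally
  (\<open>expected_matches_le_value\<close>, \<open>two_phase_value\<close>).

  Upper bounds. Given an adaptive policy, let every initiating agent independently be offered an
  assortment with the distribution of the one that the adaptive policy shows to it. This is a static
  policy. Each initiating agent still chooses \<open>j\<close> with the same probability as before
  (\<open>expectation_chose\<close>), so the backlog of \<open>j\<close> has the same marginals as before, but its elements are
  now independent. The loss is thus a correlation gap of \<open>g\<^sub>j\<close>, and \<open>correlation_gap\<close> bounds it by
  \<open>c / (1 - exp (- c))\<close> as soon as, for all \<open>S\<close> and \<open>T\<close>, the value \<open>g\<^sub>j T\<close> is at most \<open>c\<close> times \<open>g\<^sub>j S\<close>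
  plus the sum of the gains from adding a single element of \<open>T\<close> to \<open>S\<close>.
  With no constraint on the responding side \<open>g\<^sub>j\<close> is the demand itself, and \<open>c = 1\<close> by submodularity. For
  an MNL responder with a budget \<open>g\<^sub>j\<close> is a concave function of the largest total weight of an
  admissible set, and again \<open>c = 1\<close> (\<open>capped_gain_mnl\<close>). For a general demand with a budget \<open>g\<^sub>j\<close> is not
  submodular, but \<open>c = 2\<close> works by an exchange argument (\<open>capped_gain\<close>), and
  \<open>2 / (1 - exp (- 2))\<close> is below the square of \<open>e / (e - 1)\<close> because \<open>e \<le> 3\<close>.

  Lower bound. There are \<open>n\<close> suppliers and \<open>n\<^sup>2\<close> customers, all budgets are 1, a customer accepts an offer
  with probability \<open>1 / n\<close>, and a supplier accepts any customer. An adaptive policy offers only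
  suppliers that nobody has chosen so far and ends up with about \<open>n\<close> matches. A static policy can do
  no better than to split the customers evenly, which leaves a fraction \<open>(1 - 1 / n) ^ n\<close> of the
  suppliers without a customer; starting with the suppliers gives at most one match in expectation.
\<close>

section \<open>Independent random sets and the correlation gap\<close>

text \<open>
  The multilinear extension: the expected value of \<open>g\<close> at a random subset of \<open>N\<close> that contains each
  \<open>i\<close> independently with probability \<open>p i\<close>. As a polynomial in \<open>p\<close> it can be differentiated.
\<close>

definition multilinear :: "'a set \<Rightarrow> ('a \<Rightarrow> real) \<Rightarrow> ('a set \<Rightarrow> real) \<Rightarrow> real" where
  "multilinear N p g = (\<Sum>S\<in>Pow N. (\<Prod>i\<in>S. p i) * (\<Prod>i\<in>N - S. 1 - p i) * g S)"

lemma multilinear_empty [simp]: "multilinear {} p g = g {}"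
  by (simp add: multilinear_def)

lemma multilinear_insert:
  assumes "finite N" "x \<notin> N"
  shows "multilinear (insert x N) p g =
           p x * multilinear N p (\<lambda>S. g (insert x S)) + (1 - p x) * multilinear N p g"
proof -
  have [simp]: "finite S" if "S \<in> Pow N" for S
    using that assms finite_subset by auto
  have inj: "inj_on (insert x) (Pow N)"
    using assms(2) by (auto simp: inj_on_def)
  have disj: "Pow N \<inter> insert x ` Pow N = {}"
    using assms(2) by auto
  have 1: "(\<Sum>S\<in>Pow N. (\<Prod>i\<in>S. p i) * (\<Prod>i\<in>insert x N - S. 1 - p i) * g S)
      = (1 - p x) * multilinear N p g"
    unfolding multilinear_def sum_distrib_left
  proof (rule sum.cong[OF refl])
    fix S assume S: "S \<in> Pow N"
    then have "insert x N - S = insert x (N - S)" using assms(2) by auto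
    then show "(\<Prod>i\<in>S. p i) * (\<Prod>i\<in>insert x N - S. 1 - p i) * g S
        = (1 - p x) * ((\<Prod>i\<in>S. p i) * (\<Prod>i\<in>N - S. 1 - p i) * g S)"
      using assms by simp
  qed
  have 2: "(\<Sum>S\<in>Pow N. (\<Prod>i\<in>insert x S. p i) * (\<Prod>i\<in>insert x N - insert x S. 1 - p i) * g (insert x S))
      = p x * multilinear N p (\<lambda>S. g (insert x S))"
    unfolding multilinear_def sum_distrib_left
  proof (rule sum.cong[OF refl])
    fix S assume S: "S \<in> Pow N"
    then have "insert x N - insert x S = N - S" "x \<notin> S" using assms(2) by auto
    then show "(\<Prod>i\<in>insert x S. p i) * (\<Prod>i\<in>insert x N - insert x S. 1 - p i) * g (insert x S)
        = p x * ((\<Prod>i\<in>S. p i) * (\<Prod>i\<in>N - S. 1 - p i) * g (insert x S))"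
      using S by simp
  qed
  show ?thesis
    unfolding multilinear_def[of "insert x N"] Pow_insert
    by (subst sum.union_disjoint) (use assms disj inj 1 2 in \<open>auto simp: sum.reindex\<close>)
qed

lemma multilinear_cong:
  "(\<And>S. S \<subseteq> N \<Longrightarrow> g S = g' S) \<Longrightarrow> multilinear N p g = multilinear N p g'"
  unfolding multilinear_def by (intro sum.cong) auto

lemma multilinear_cong_prob:
  "(\<And>i. i \<in> N \<Longrightarrow> p i = p' i) \<Longrightarrow> multilinear N p g = multilinear N p' g"
  unfolding multilinear_def
  by (intro sum.cong arg_cong2[where f = "(*)"] prod.cong refl) auto

lemma multilinear_diff:
  "multilinear N p (\<lambda>S. g S - g' S) = multilinear N p g - multilinear N p g'"
  unfolding multilinear_def by (simp add: right_diff_distrib sum_subtractf)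

lemma multilinear_cmult:
  "multilinear N p (\<lambda>S. c * g S) = c * multilinear N p g"
  unfolding multilinear_def sum_distrib_left by (intro sum.cong) auto

lemma multilinear_sum:
  "multilinear N p (\<lambda>S. \<Sum>i\<in>A. g i S) = (\<Sum>i\<in>A. multilinear N p (g i))"
  unfolding multilinear_def sum_distrib_left by (rule sum.swap)

lemma multilinear_const:
  "finite N \<Longrightarrow> multilinear N p (\<lambda>_. c) = c"
  by (induction N rule: finite_induct) (simp_all add: multilinear_insert algebra_simps)

lemma multilinear_mono:
  assumes "\<And>i. i \<in> N \<Longrightarrow> 0 \<le> p i \<and> p i \<le> 1" "\<And>S. S \<subseteq> N \<Longrightarrow> g S \<le> g' S"
  shows "multilinear N p g \<le> multilinear N p g'"
  unfolding multilinear_def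
  by (intro sum_mono mult_left_mono mult_nonneg_nonneg prod_nonneg) (use assms in auto)

text \<open>
  The extension is affine in each coordinate, so the partial derivative in direction \<open>i\<close> is the
  expected difference between putting \<open>i\<close> into the random set and leaving it out.
\<close>

lemma multilinear_has_derivative:
  assumes "finite N"
  shows "((\<lambda>t. multilinear N (\<lambda>i. t * z i) g) has_real_derivative
           (\<Sum>i\<in>N. z i * (multilinear N (\<lambda>i. t * z i) (\<lambda>S. g (insert i S)) -
                           multilinear N (\<lambda>i. t * z i) (\<lambda>S. g (S - {i}))))) (at t)"
  using assms
proof (induction N arbitrary: g rule: finite_induct)
  case empty
  then show ?case by simp
next
  case (insert x N)
  let ?M = "multilinear N (\<lambda>i. t * z i)"
  let ?D = "\<lambda>g. \<Sum>i\<in>N. z i * (?M (\<lambda>S. g (insert i S)) - ?M (\<lambda>S. g (S - {i})))"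
  let ?gx = "\<lambda>S. g (insert x S)"
  have eq: "(\<lambda>t. multilinear (insert x N) (\<lambda>i. t * z i) g) =
      (\<lambda>t. (t * z x) * multilinear N (\<lambda>i. t * z i) ?gx +
            (1 - t * z x) * multilinear N (\<lambda>i. t * z i) g)"
    using insert.hyps by (simp add: multilinear_insert)
  have d: "((\<lambda>t. multilinear (insert x N) (\<lambda>i. t * z i) g) has_real_derivative
      (z x * ?M ?gx + t * z x * ?D ?gx + (- z x * ?M g + (1 - t * z x) * ?D g))) (at t)"
    unfolding eq
    by (rule derivative_eq_intros insert.IH refl | simp)+
  have x: "?M (\<lambda>S. g (S - {x})) = ?M g"
    using insert.hyps by (intro multilinear_cong) (metis Diff_empty Diff_insert0 subsetD)
  have i: "multilinear (insert x N) (\<lambda>i. t * z i) (\<lambda>S. g (insert i S)) -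
           multilinear (insert x N) (\<lambda>i. t * z i) (\<lambda>S. g (S - {i})) =
      t * z x * (?M (\<lambda>S. ?gx (insert i S)) - ?M (\<lambda>S. ?gx (S - {i}))) +
      (1 - t * z x) * (?M (\<lambda>S. g (insert i S)) - ?M (\<lambda>S. g (S - {i})))"
    if "i \<in> N" for i
  proof -
    from that insert.hyps have "x \<noteq> i" by auto
    then have "insert x S - {i} = insert x (S - {i})" for S by auto
    then show ?thesis
      using insert.hyps by (simp add: multilinear_insert insert_commute algebra_simps)
  qed
  have "(\<Sum>i\<in>insert x N. z i * (multilinear (insert x N) (\<lambda>i. t * z i) (\<lambda>S. g (insert i S)) -
           multilinear (insert x N) (\<lambda>i. t * z i) (\<lambda>S. g (S - {i})))) =
      z x * (?M ?gx - ?M g) +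
      (\<Sum>i\<in>N. z i * (t * z x * (?M (\<lambda>S. ?gx (insert i S)) - ?M (\<lambda>S. ?gx (S - {i}))) +
      (1 - t * z x) * (?M (\<lambda>S. g (insert i S)) - ?M (\<lambda>S. g (S - {i})))))"
    unfolding sum.insert[OF insert.hyps]
  proof (intro arg_cong2[where f = "(+)"] sum.cong refl, goal_cases)
    case 1
    show ?case using insert.hyps x by (simp add: multilinear_insert algebra_simps)
  next
    case (2 j)
    then show ?case by (simp only: i)
  qed
  also have "\<dots> = z x * ?M ?gx + t * z x * ?D ?gx + (- z x * ?M g + (1 - t * z x) * ?D g)"
    by (simp add: algebra_simps sum.distrib sum_distrib_left sum_subtractf)
  finally show ?case using d by simp
qed

text \<open>
  Let the inclusion probabilities grow along \<open>t * z\<close> for \<open>t\<close> from 0 to 1, and let \<open>G t\<close> be the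
  expected value at time \<open>t\<close>. The assumption on the gains says \<open>G' \<ge> V - c * G\<close>, and \<open>G 0 \<ge> 0\<close>.
  Comparison with the solution \<open>(1 - exp (- c * t)) * V / c\<close> of the corresponding equation at
  \<open>t = 1\<close> gives the bound.
\<close>

lemma multilinear_lower_bound:
  assumes fin: "finite N" and z: "\<And>i. i \<in> N \<Longrightarrow> 0 \<le> z i \<and> z i \<le> 1" and c: "c > 0"
    and mono: "\<And>S T. S \<subseteq> T \<Longrightarrow> T \<subseteq> N \<Longrightarrow> g S \<le> g T" and g0: "g {} \<ge> 0"
    and gain: "\<And>S. S \<subseteq> N \<Longrightarrow> V \<le> c * g S + (\<Sum>i\<in>N. z i * (g (insert i S) - g S))"
  shows "(1 - exp (- c)) / c * V \<le> multilinear N z g"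
proof -
  let ?G = "\<lambda>t. multilinear N (\<lambda>i. t * z i) g"
  let ?G' = "\<lambda>t. (\<Sum>i\<in>N. z i * (multilinear N (\<lambda>i. t * z i) (\<lambda>S. g (insert i S)) -
                           multilinear N (\<lambda>i. t * z i) (\<lambda>S. g (S - {i}))))"
  \<comment> \<open>The integrating factor turns the differential inequality into monotonicity.\<close>
  define h where "h = (\<lambda>t. exp (c * t) * (?G t - V / c))"
  have G': "V - c * ?G t \<le> ?G' t" if t: "0 \<le> t" "t \<le> 1" for t
  proof -
    have p: "0 \<le> t * z i \<and> t * z i \<le> 1" if "i \<in> N" for i
      using t z[OF that] by (simp add: mult_le_one)
    have "V - c * ?G t = multilinear N (\<lambda>i. t * z i) (\<lambda>S. V - c * g S)"
      using fin by (simp add: multilinear_diff multilinear_const multilinear_cmult)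
    also have "\<dots> \<le> multilinear N (\<lambda>i. t * z i)
        (\<lambda>S. \<Sum>i\<in>N. z i * (g (insert i S) - g (S - {i})))"
    proof (rule multilinear_mono[OF p])
      fix S assume S: "S \<subseteq> N"
      have "(\<Sum>i\<in>N. z i * (g (insert i S) - g S)) \<le> (\<Sum>i\<in>N. z i * (g (insert i S) - g (S - {i})))"
        using S z by (intro sum_mono mult_left_mono diff_left_mono mono) auto
      with gain[OF S] show "V - c * g S \<le> (\<Sum>i\<in>N. z i * (g (insert i S) - g (S - {i})))"
        by linarith
    qed
    also have "\<dots> = ?G' t"
      by (simp add: multilinear_sum multilinear_cmult multilinear_diff)
    finally show ?thesis .
  qed
  have "h 0 \<le> h 1"
  proof (rule DERIV_nonneg_imp_nondecreasing[where f = h and a = 0 and b = 1])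
    fix t :: real assume t: "0 \<le> t" "t \<le> 1"
    have "((\<lambda>t. exp (c * t)) has_real_derivative (exp (c * t) * c)) (at t)"
      by (auto intro!: derivative_eq_intros)
    moreover have "((\<lambda>t. ?G t - V / c) has_real_derivative ?G' t) (at t)"
      using DERIV_diff[OF multilinear_has_derivative[OF fin] DERIV_const] by simp
    ultimately have "(h has_real_derivative (exp (c * t) * c * (?G t - V / c) + ?G' t * exp (c * t))) (at t)"
      unfolding h_def by (rule DERIV_mult)
    also have "exp (c * t) * c * (?G t - V / c) + ?G' t * exp (c * t) =
        exp (c * t) * (?G' t + c * ?G t - V)"
      using c by (simp add: algebra_simps)
    finally have "(h has_real_derivative (exp (c * t) * (?G' t + c * ?G t - V))) (at t)" .
    moreover have "0 \<le> exp (c * t) * (?G' t + c * ?G t - V)"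
      using G'[OF t] by simp
    ultimately show "\<exists>y. (h has_real_derivative y) (at t) \<and> 0 \<le> y" by blast
  qed simp
  moreover have "?G 0 \<ge> 0"
  proof -
    have "multilinear N (\<lambda>i. 0 * z i) (\<lambda>_. 0) \<le> ?G 0"
    proof (rule multilinear_mono)
      show "0 \<le> g S" if "S \<subseteq> N" for S
        using order_trans[OF g0 mono[OF empty_subsetI that]] .
    qed simp
    then show ?thesis by (simp add: multilinear_const[OF fin])
  qed
  ultimately have "- V / c \<le> exp c * (multilinear N z g - V / c)"
    by (simp add: h_def)
  then have "exp (- c) * (- V / c) \<le> exp (- c) * (exp c * (multilinear N z g - V / c))"
    by (intro mult_left_mono) auto
  then have "exp (- c) * (- V / c) \<le> multilinear N z g - V / c"
    by (simp add: mult.assoc[symmetric] exp_add[symmetric])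
  then show ?thesis
    by (simp add: left_diff_distrib right_diff_distrib diff_divide_distrib mult.commute)
qed

lemma expectation_bind_pmf:
  fixes f :: "'b \<Rightarrow> real"
  assumes "\<And>y. \<bar>f y\<bar> \<le> B"
  shows "measure_pmf.expectation (bind_pmf p q) f =
           measure_pmf.expectation p (\<lambda>x. measure_pmf.expectation (q x) f)"
  unfolding measure_pmf_bind
  by (rule integral_bind[where B' = 1 and K = "count_space UNIV" and B = B])
     (use assms in \<open>auto simp: space_subprob_algebra measure_pmf.emeasure_space_le_1
        intro: measure_pmf.subprob_space_axioms\<close>)

text \<open>
  Outside the support of the mixture the integrand can be set to 0, which makes it bounded.
\<close>

lemma expectation_bind_pmf_finite:
  fixes f :: "'b \<Rightarrow> real"
  assumes "finite (set_pmf (bind_pmf p q))"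
  shows "measure_pmf.expectation (bind_pmf p q) f =
           measure_pmf.expectation p (\<lambda>x. measure_pmf.expectation (q x) f)"
proof -
  let ?f = "\<lambda>y. if y \<in> set_pmf (bind_pmf p q) then f y else 0"
  have "measure_pmf.expectation (bind_pmf p q) f = measure_pmf.expectation (bind_pmf p q) ?f"
    by (intro integral_cong_AE AE_pmfI) auto
  also have "\<dots> = measure_pmf.expectation p (\<lambda>x. measure_pmf.expectation (q x) ?f)"
    using assms by (intro expectation_bind_pmf[where B = "\<Sum>y\<in>set_pmf (bind_pmf p q). \<bar>f y\<bar>"])
      (auto intro!: sum_nonneg member_le_sum[where f = "\<lambda>y. \<bar>f y\<bar>"])
  also have "\<dots> = measure_pmf.expectation p (\<lambda>x. measure_pmf.expectation (q x) f)"
    by (intro integral_cong_AE AE_pmfI) auto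
  finally show ?thesis .
qed

lemma expectation_independent_set_bounded:
  fixes g :: "'a set \<Rightarrow> real"
  assumes "finite N" "\<And>S. \<bar>g S\<bar> \<le> B"
  shows "measure_pmf.expectation (Pi_pmf N None p) (\<lambda>ch. g {i\<in>N. ch i = Some j}) =
           multilinear N (\<lambda>i. pmf (p i) (Some j)) g"
  using assms
proof (induction N arbitrary: g rule: finite_induct)
  case empty
  then show ?case by simp
next
  case (insert x N)
  let ?P = "Pi_pmf N None p"
  let ?g = "\<lambda>y. if y = Some j then measure_pmf.expectation ?P (\<lambda>ch. g (insert x {i\<in>N. ch i = Some j}))
      else measure_pmf.expectation ?P (\<lambda>ch. g {i\<in>N. ch i = Some j})"
  have "measure_pmf.expectation (Pi_pmf (insert x N) None p) (\<lambda>ch. g {i\<in>insert x N. ch i = Some j})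
    = measure_pmf.expectation (p x) (\<lambda>y. measure_pmf.expectation ?P
        (\<lambda>ch. g {i\<in>insert x N. (ch(x := y)) i = Some j}))"
    unfolding Pi_pmf_insert'[OF insert.hyps]
    by (subst expectation_bind_pmf[where B = B], rule insert.prems)
       (simp add: map_pmf_def[symmetric])
  also have "\<dots> = measure_pmf.expectation (p x) ?g"
  proof (intro Bochner_Integration.integral_cong refl)
    fix y
    have "{i\<in>insert x N. (ch(x := y)) i = Some j} =
        (if y = Some j then insert x {i\<in>N. ch i = Some j} else {i\<in>N. ch i = Some j})" for ch
      using insert.hyps by auto
    then show "measure_pmf.expectation ?P (\<lambda>ch. g {i\<in>insert x N. (ch(x := y)) i = Some j}) = ?g y"
      by simp
  qed
  also have "?g = (\<lambda>y. multilinear N (\<lambda>i. pmf (p i) (Some j)) g +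
      (multilinear N (\<lambda>i. pmf (p i) (Some j)) (\<lambda>S. g (insert x S)) -
       multilinear N (\<lambda>i. pmf (p i) (Some j)) g) * indicator {Some j} y)"
    using insert.IH[of g] insert.IH[of "\<lambda>S. g (insert x S)"] insert.prems
    by (auto simp: indicator_def)
  also have "measure_pmf.expectation (p x) \<dots> =
      multilinear N (\<lambda>i. pmf (p i) (Some j)) g +
      (multilinear N (\<lambda>i. pmf (p i) (Some j)) (\<lambda>S. g (insert x S)) -
       multilinear N (\<lambda>i. pmf (p i) (Some j)) g) * pmf (p x) (Some j)"
    by (simp add: measure_pmf_single measure_pmf.emeasure_eq_measure)
  finally show ?case
    using insert.hyps by (simp add: multilinear_insert algebra_simps)
qed

lemma expectation_independent_set:
  fixes g :: "'a set \<Rightarrow> real"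
  assumes "finite N"
  shows "measure_pmf.expectation (Pi_pmf N None p) (\<lambda>ch. g {i\<in>N. ch i = Some j}) =
           multilinear N (\<lambda>i. pmf (p i) (Some j)) g"
proof -
  let ?g = "\<lambda>S. g (S \<inter> N)"
  have eq: "{i\<in>N. ch i = Some j} \<inter> N = {i\<in>N. ch i = Some j}" for ch :: "'a \<Rightarrow> 'b option"
    by auto
  have bounded: "\<And>S. \<bar>?g S\<bar> \<le> (\<Sum>S\<in>Pow N. \<bar>g S\<bar>)"
    using assms by (intro member_le_sum[where f = "\<lambda>S. \<bar>g S\<bar>"]) auto
  have "measure_pmf.expectation (Pi_pmf N None p) (\<lambda>ch. g {i\<in>N. ch i = Some j}) =
           multilinear N (\<lambda>i. pmf (p i) (Some j)) ?g"
    using expectation_independent_set_bounded[of N ?g, OF assms bounded, of p j] unfolding eq .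
  also have "\<dots> = multilinear N (\<lambda>i. pmf (p i) (Some j)) g"
    by (intro multilinear_cong) (simp add: Int_absorb2)
  finally show ?thesis .
qed

text \<open>
  Whatever the joint distribution \<open>\<mu>\<close> of the elements is, making them independent with the same
  marginals costs at most the factor \<open>(1 - exp (- c)) / c\<close>: averaging the assumed inequality over \<open>T\<close>
  drawn from \<open>\<mu>\<close> yields the hypothesis of the preceding lemma with the marginals of \<open>\<mu>\<close> as \<open>z\<close>. For
  \<open>c = 1\<close> the assumption holds for every monotone submodular function.
\<close>

lemma correlation_gap:
  fixes g :: "'a set \<Rightarrow> real"
  assumes fin: "finite N" and supp: "set_pmf \<mu> \<subseteq> Pow N" and c: "c > 0"
    and mono: "\<And>S T. S \<subseteq> T \<Longrightarrow> T \<subseteq> N \<Longrightarrow> g S \<le> g T" and g0: "g {} \<ge> 0"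
    and gain: "\<And>S T. S \<subseteq> N \<Longrightarrow> T \<subseteq> N \<Longrightarrow> g T \<le> c * g S + (\<Sum>i\<in>T. g (insert i S) - g S)"
  shows "(1 - exp (- c)) / c * measure_pmf.expectation \<mu> g \<le>
           multilinear N (\<lambda>i. measure_pmf.prob \<mu> {T. i \<in> T}) g"
proof (rule multilinear_lower_bound)
  show "finite N" "0 < c" "0 \<le> g {}" by (fact fin c g0)+
  show "g S \<le> g T" if "S \<subseteq> T" "T \<subseteq> N" for S T using mono[OF that] .
  show "0 \<le> measure_pmf.prob \<mu> {T. i \<in> T} \<and> measure_pmf.prob \<mu> {T. i \<in> T} \<le> 1" for i by simp
  fix S assume S: "S \<subseteq> N"
  have fs: "finite (set_pmf \<mu>)" using supp fin finite_subset by blast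
  note int = integrable_measure_pmf_finite[OF fs]
  have "measure_pmf.expectation \<mu> g \<le> measure_pmf.expectation \<mu>
      (\<lambda>T. c * g S + (\<Sum>i\<in>N. (g (insert i S) - g S) * indicator {T. i \<in> T} T))"
  proof (rule integral_mono_AE[OF int int], rule AE_pmfI)
    fix T assume "T \<in> set_pmf \<mu>"
    with supp have T: "T \<subseteq> N" by auto
    have "(\<Sum>i\<in>N. (g (insert i S) - g S) * indicator {T. i \<in> T} T) = (\<Sum>i\<in>T. g (insert i S) - g S)"
      using T fin by (intro sum.mono_neutral_cong_right) auto
    with gain[OF S T] show "g T \<le> c * g S + (\<Sum>i\<in>N. (g (insert i S) - g S) * indicator {T. i \<in> T} T)"
      by simp
  qed
  also have "\<dots> = c * g S + (\<Sum>i\<in>N. measure_pmf.prob \<mu> {T. i \<in> T} * (g (insert i S) - g S))"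
    by (simp add: int mult.commute)
  finally show "measure_pmf.expectation \<mu> g \<le> \<dots>" .
qed

section \<open>Responses under a cardinality constraint\<close>

lemma submodular_onD:
  "submodular_on N f \<Longrightarrow> X \<subseteq> N \<Longrightarrow> Y \<subseteq> N \<Longrightarrow> f (X \<union> Y) + f (X \<inter> Y) \<le> f X + f Y"
  by (auto simp: submodular_on_def)

lemma submodular_on_union_le:
  assumes f: "submodular_on N f" and S: "S \<subseteq> N" and T: "T \<subseteq> N" "finite T"
  shows "f (S \<union> T) \<le> f S + (\<Sum>i\<in>T. f (insert i S) - f S)"
  using T(2,1)
proof (induction T rule: finite_induct)
  case empty
  then show ?case by simp
next
  case (insert x T)
  show ?case
  proof (cases "x \<in> S")
    case True
    then show ?thesis using insert by (simp add: insert_absorb)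
  next
    case False
    have "f ((S \<union> T) \<union> insert x S) + f ((S \<union> T) \<inter> insert x S) \<le> f (S \<union> T) + f (insert x S)"
      using S insert.prems by (intro submodular_onD[OF f]) auto
    moreover have "(S \<union> T) \<union> insert x S = S \<union> insert x T" by auto
    moreover have "(S \<union> T) \<inter> insert x S = S" using False insert.hyps by auto
    ultimately show ?thesis using insert by simp
  qed
qed

lemma submodular_on_sum_drop_le:
  assumes f: "submodular_on N f" and B: "B \<subseteq> N" and A: "A \<subseteq> B" "finite A"
  shows "(\<Sum>b\<in>A. f B - f (B - {b})) \<le> f B - f (B - A)"
  using A(2,1)
proof (induction A rule: finite_induct)
  case empty
  then show ?case by simp
next
  case (insert x A)
  have "f ((B - A) \<union> (B - {x})) + f ((B - A) \<inter> (B - {x})) \<le> f (B - A) + f (B - {x})"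
    using B by (intro submodular_onD[OF f]) auto
  moreover have "(B - A) \<union> (B - {x}) = B" using insert by auto
  moreover have "(B - A) \<inter> (B - {x}) = B - insert x A" by auto
  ultimately show ?case using insert by simp
qed

text \<open>
  For the demand \<open>f\<close> of a responding agent with budget \<open>k\<close>, this is the largest probability of a match
  that it can contribute when \<open>C\<close> is the set of agents that chose it. The budget \<open>\<infinity>\<close> is allowed.
\<close>

definition capped :: "('a set \<Rightarrow> real) \<Rightarrow> enat \<Rightarrow> 'a set \<Rightarrow> real" where
  "capped f k C = Max (f ` {B. B \<subseteq> C \<and> enat (card B) \<le> k})"

lemma capped_attained:
  assumes "finite C"
  obtains B where "B \<subseteq> C" "enat (card B) \<le> k" "f B = capped f k C"
proof -
  let ?A = "{B. B \<subseteq> C \<and> enat (card B) \<le> k}"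
  have "{} \<in> ?A" by (simp add: zero_enat_def[symmetric])
  moreover have "finite ?A" using assms by auto
  ultimately have "capped f k C \<in> f ` ?A"
    unfolding capped_def by (intro Max_in) auto
  then show ?thesis using that by auto
qed

lemma capped_upper:
  assumes "finite C" "B \<subseteq> C" "enat (card B) \<le> k"
  shows "f B \<le> capped f k C"
  unfolding capped_def using assms by (intro Max_ge) auto

lemma capped_le_iff:
  assumes "finite C"
  shows "capped f k C \<le> v \<longleftrightarrow> (\<forall>B\<subseteq>C. enat (card B) \<le> k \<longrightarrow> f B \<le> v)"
proof -
  have "{} \<in> {B. B \<subseteq> C \<and> enat (card B) \<le> k}" by (simp add: zero_enat_def[symmetric])
  then show ?thesis
    unfolding capped_def using assms by (subst Max_le_iff) auto
qed

lemma capped_mono: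
  assumes "C \<subseteq> C'" "finite C'"
  shows "capped f k C \<le> capped f k C'"
  using assms finite_subset by (subst capped_le_iff) (auto intro!: capped_upper)

lemma capped_empty [simp]:
  fixes f :: "'a set \<Rightarrow> real"
  shows "capped f k {} = f {}"
proof -
  have "{B :: 'a set. B \<subseteq> {} \<and> enat (card B) \<le> k} = {{}}" by (auto simp: zero_enat_def[symmetric])
  then show ?thesis by (simp add: capped_def del: subset_empty)
qed

lemma capped_infinity:
  assumes "finite C" "\<And>B. B \<subseteq> C \<Longrightarrow> f B \<le> f C"
  shows "capped f \<infinity> C = f C"
  using assms by (intro antisym) (auto simp: capped_le_iff intro: capped_upper)

locale monotone_submodular =
  fixes N :: "'a set" and f :: "'a set \<Rightarrow> real"
  assumes finite_N: "finite N"
    and submod: "submodular_on N f"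
    and mono: "mono_on (Pow N) f"
    and empty: "f {} = 0"
begin

lemma le: "S \<subseteq> T \<Longrightarrow> T \<subseteq> N \<Longrightarrow> f S \<le> f T"
  using mono by (auto simp: mono_on_def)

lemma nonneg: "S \<subseteq> N \<Longrightarrow> 0 \<le> f S"
  using le[of "{}" S] empty by simp

lemma fin: "S \<subseteq> N \<Longrightarrow> finite S"
  using finite_N finite_subset by blast

lemma sum_gain_le_sum_capped_gain:
  assumes S: "S \<subseteq> N" and T: "T \<subseteq> N" and B: "B \<subseteq> T"
    and gain: "\<And>i. i \<in> B \<Longrightarrow> d i \<le> capped f k (insert i S) - capped f k S"
  shows "(\<Sum>i\<in>B. d i) \<le> (\<Sum>i\<in>T. capped f k (insert i S) - capped f k S)"
proof -
  have "(\<Sum>i\<in>B. d i) \<le> (\<Sum>i\<in>B. capped f k (insert i S) - capped f k S)"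
    using gain by (rule sum_mono)
  also have "\<dots> \<le> (\<Sum>i\<in>T. capped f k (insert i S) - capped f k S)"
    using fin[OF T] fin[OF S] B by (intro sum_mono2) (auto intro!: capped_mono)
  finally show ?thesis .
qed

text \<open>
  As long as an optimal set for \<open>S\<close> leaves a slot free, every element of \<open>T\<close> can be added to it, so
  that the capped function gains at least as much as \<open>f\<close> itself, and submodularity of \<open>f\<close> applies.
\<close>

lemma capped_gain_unsaturated:
  assumes S: "S \<subseteq> N" and T: "T \<subseteq> N"
    and B: "B \<subseteq> S" "f B = capped f k S" "enat (card B) < k"
  shows "capped f k T \<le> capped f k S + (\<Sum>i\<in>T. capped f k (insert i S) - capped f k S)"
proof -
  obtain B' where B': "B' \<subseteq> T" "f B' = capped f k T"
    using capped_attained[OF fin[OF T]] by metis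
  have sub: "B \<subseteq> N" "B' \<subseteq> N" using S T B B' by auto
  have "f B' \<le> f (B \<union> B')" using sub by (intro le) auto
  also have "\<dots> \<le> f B + (\<Sum>i\<in>B'. f (insert i B) - f B)"
    using submodular_on_union_le[OF submod sub fin[OF sub(2)]] .
  also have "(\<Sum>i\<in>B'. f (insert i B) - f B) \<le> (\<Sum>i\<in>T. capped f k (insert i S) - capped f k S)"
  proof (rule sum_gain_le_sum_capped_gain[OF S T B'(1)])
    fix i
    have "enat (card (insert i B)) \<le> enat (Suc (card B))"
      by (simp add: card_insert_le_m1 card_insert_if fin[OF sub(1)])
    also have "\<dots> \<le> k" using B(3) by (simp add: Suc_ile_eq)
    finally have "f (insert i B) \<le> capped f k (insert i S)"
      using fin[OF S] B(1) by (intro capped_upper) auto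
    then show "f (insert i B) - f B \<le> capped f k (insert i S) - capped f k S"
      using B(2) by simp
  qed
  finally show ?thesis using B B' by simp
qed

text \<open>
  If an optimal set \<open>B\<close> for \<open>S\<close> fills all slots, a new element \<open>i\<close> has to displace some \<open>b \<in> B\<close>. By
  submodularity the losses \<open>f B - f (B - {b})\<close> add up to at most \<open>f B\<close>, so displacing an average \<open>b\<close>
  costs at most \<open>f B / card B\<close>. At most \<open>card B\<close> elements of an optimal set for \<open>T\<close> are added, so
  these costs amount to one further \<open>f B\<close>; hence the factor 2.
\<close>

lemma capped_gain:
  assumes S: "S \<subseteq> N" and T: "T \<subseteq> N" and k: "k > 0"
  shows "capped f k T \<le> 2 * capped f k S + (\<Sum>i\<in>T. capped f k (insert i S) - capped f k S)"
proof -
  obtain B where B: "B \<subseteq> S" "enat (card B) \<le> k" "f B = capped f k S"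
    using capped_attained[OF fin[OF S]] by metis
  have BN: "B \<subseteq> N" using B S by auto
  show ?thesis
  proof (cases "enat (card B) < k")
    case True
    from capped_gain_unsaturated[OF S T B(1,3) True] nonneg[OF BN] B(3) show ?thesis by simp
  next
    case False
    then have kB: "k = enat (card B)" using B(2) by simp
    with k have pos: "card B > 0" by (simp add: zero_enat_def)
    obtain B' where B': "B' \<subseteq> T" "enat (card B') \<le> k" "f B' = capped f k T"
      using capped_attained[OF fin[OF T]] by metis
    have B'N: "B' \<subseteq> N" using B' T by auto
    have gain: "(f (insert i B) - f B) - f B / card B \<le> capped f k (insert i S) - capped f k S"
      if i: "i \<in> B'" for i
    proof (cases "i \<in> B")
      case True
      have "capped f k S \<le> capped f k (insert i S)" using fin[OF S] by (intro capped_mono) auto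
      moreover have "0 \<le> f B / card B" using nonneg[OF BN] by simp
      moreover have "insert i B = B" using True by auto
      ultimately show ?thesis by simp
    next
      case False
      have swap: "f (insert i B) - (f B - f (B - {b})) \<le> capped f k (insert i S)" if b: "b \<in> B" for b
      proof -
        have "card (insert i (B - {b})) = card B"
          using b False fin[OF BN] pos by simp
        then have "f (insert i (B - {b})) \<le> capped f k (insert i S)"
          using fin[OF S] B(1) kB by (intro capped_upper) auto
        moreover have "f (B \<union> insert i (B - {b})) + f (B \<inter> insert i (B - {b}))
            \<le> f B + f (insert i (B - {b}))"
          using BN B'N i by (intro submodular_onD[OF submod]) auto
        moreover have "B \<union> insert i (B - {b}) = insert i B" "B \<inter> insert i (B - {b}) = B - {b}"
          using False by auto
        ultimately show ?thesis by simp
      qed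
      \<comment> \<open>Sum over all the elements that may be displaced by \<open>i\<close>.\<close>
      have "card B * f (insert i B) - f B \<le> (\<Sum>b\<in>B. f (insert i B) - (f B - f (B - {b})))"
        using submodular_on_sum_drop_le[OF submod BN order_refl fin[OF BN]] empty
        by (simp add: sum_subtractf)
      also have "\<dots> \<le> card B * capped f k (insert i S)"
        using sum_mono[OF swap] by simp
      finally have "f (insert i B) - f B / card B \<le> capped f k (insert i S)"
        using pos by (simp add: field_simps)
      then show ?thesis using B(3) by simp
    qed
    have "f B' \<le> f (B \<union> B')" using BN B'N by (intro le) auto
    also have "\<dots> \<le> f B + (\<Sum>i\<in>B'. f (insert i B) - f B)"
      using submodular_on_union_le[OF submod BN B'N fin[OF B'N]] .
    also have "(\<Sum>i\<in>B'. f (insert i B) - f B) =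
        (\<Sum>i\<in>B'. (f (insert i B) - f B) - f B / card B) + card B' * (f B / card B)"
      by (simp add: sum_subtractf)
    also have "(\<Sum>i\<in>B'. (f (insert i B) - f B) - f B / card B)
        \<le> (\<Sum>i\<in>T. capped f k (insert i S) - capped f k S)"
      by (rule sum_gain_le_sum_capped_gain[OF S T B'(1) gain])
    also have "card B' * (f B / card B) \<le> card B * (f B / card B)"
      using B'(2) kB nonneg[OF BN] by (intro mult_right_mono) auto
    also have "\<dots> = f B" using pos by simp
    finally show ?thesis using B(3) B'(3) by simp
  qed
qed

lemma capped_gain_infinity:
  assumes S: "S \<subseteq> N" and T: "T \<subseteq> N"
  shows "capped f \<infinity> T \<le> capped f \<infinity> S + (\<Sum>i\<in>T. capped f \<infinity> (insert i S) - capped f \<infinity> S)"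
  by (rule capped_gain_unsaturated[OF S T order_refl])
     (use S fin le in \<open>auto intro!: capped_infinity[symmetric]\<close>)

text \<open>
  For MNL demand an optimal set consists of the elements with the largest weights, and its value is
  \<open>h w = w / (1 + w)\<close> where \<open>w\<close> is their total weight. A full optimal set \<open>B\<close> for \<open>S\<close> is turned into an
  optimal set \<open>B'\<close> for \<open>T\<close> by displacing a different element for each new one. By concavity of \<open>h\<close>, the
  sum of the gains of the single exchanges is at least the gain from making all of them at once.
\<close>

lemma capped_gain_mnl:
  assumes u: "\<And>i. i \<in> N \<Longrightarrow> 0 \<le> u i"
    and f: "\<And>B. B \<subseteq> N \<Longrightarrow> f B = sum u B / (1 + sum u B)"
    and S: "S \<subseteq> N" and T: "T \<subseteq> N"
  shows "capped f k T \<le> capped f k S + (\<Sum>i\<in>T. capped f k (insert i S) - capped f k S)"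
proof -
  obtain B where B: "B \<subseteq> S" "enat (card B) \<le> k" "f B = capped f k S"
    using capped_attained[OF fin[OF S]] by metis
  have BN: "B \<subseteq> N" using B S by auto
  show ?thesis
  proof (cases "enat (card B) < k")
    case True
    from capped_gain_unsaturated[OF S T B(1,3) True] show ?thesis .
  next
    case False
    then have kB: "k = enat (card B)" using B(2) by simp
    obtain B' where B': "B' \<subseteq> T" "enat (card B') \<le> k" "f B' = capped f k T"
      using capped_attained[OF fin[OF T]] by metis
    have B'N: "B' \<subseteq> N" using B' T by auto
    note fB = fin[OF BN] and fB' = fin[OF B'N]
    \<comment> \<open>Since \<open>B'\<close> is not larger than \<open>B\<close>, the elements of \<open>B' - B\<close> can be matched with different elements of \<open>B - B'\<close>.\<close>
    have "card (B' - B) + card (B' \<inter> B) \<le> card (B - B') + card (B' \<inter> B)"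
      using B'(2) kB card_Int_Diff[OF fB', of B] card_Int_Diff[OF fB, of B'] by (simp add: Int_commute)
    then have "\<exists>\<rho>. \<rho> ` (B' - B) \<subseteq> B - B' \<and> inj_on \<rho> (B' - B)"
      by (intro card_le_inj) (use fB fB' in auto)
    then obtain \<rho> where \<rho>: "\<rho> ` (B' - B) \<subseteq> B - B'" "inj_on \<rho> (B' - B)" by auto
    define h where "h = (\<lambda>w :: real. w / (1 + w))"
    define w where "w = sum u B"
    \<comment> \<open>The weight gained by letting \<open>i\<close> displace \<open>\<rho> i\<close>, or 0 if the exchange does not pay.\<close>
    define d where "d i = max 0 (u i - u (\<rho> i))" for i
    have w0: "w \<ge> 0" unfolding w_def using u BN by (intro sum_nonneg) auto
    have d0: "d i \<ge> 0" for i by (simp add: d_def)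
    have h_mono: "h x \<le> h y" if "0 \<le> x" "x \<le> y" for x y
      using that by (simp add: h_def field_simps)
    have h_diff: "h (w + x) - h w = x / ((1 + w) * (1 + w + x))" if "x \<ge> 0" for x
      using that w0 by (simp add: h_def divide_simps) (simp add: algebra_simps)
    have fS: "h w = capped f k S" using f[OF BN] B(3) by (simp add: h_def w_def)
    have gain: "h (w + d i) - h w \<le> capped f k (insert i S) - capped f k S" if i: "i \<in> B' - B" for i
    proof (cases "u i \<le> u (\<rho> i)")
      case True
      then have "h (w + d i) = h w" by (simp add: d_def)
      moreover have "capped f k S \<le> capped f k (insert i S)" using fin[OF S] by (intro capped_mono) auto
      ultimately show ?thesis by simp
    next
      case False
      let ?Bi = "insert i (B - {\<rho> i})"
      have \<rho>i: "\<rho> i \<in> B" using \<rho>(1) i by auto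
      have "?Bi \<subseteq> N" using BN B'N i by auto
      then have "f ?Bi = h (sum u ?Bi)" by (simp add: f h_def)
      also have "sum u ?Bi = w + d i"
        using i fB \<rho>i False by (simp add: w_def d_def sum_diff1)
      finally have "f ?Bi = h (w + d i)" .
      moreover have "card ?Bi = card B"
        using i fB \<rho>i by (metis DiffD2 DiffD1 card_Suc_Diff1 card_insert_disjoint finite_Diff)
      then have "f ?Bi \<le> capped f k (insert i S)"
        using fin[OF S] B(1) kB by (intro capped_upper) auto
      ultimately show ?thesis using fS by simp
    qed
    let ?d = "\<Sum>i\<in>B' - B. d i"
    have d0': "?d \<ge> 0" using d0 by (rule sum_nonneg)
    have "sum u B' \<le> w + ?d"
    proof -
      have "(\<Sum>i\<in>B' - B. u (\<rho> i)) = sum u (\<rho> ` (B' - B))"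
        using \<rho>(2) by (simp add: sum.reindex)
      also have "\<dots> \<le> sum u (B - B')"
        using \<rho>(1) fB u BN by (intro sum_mono2) auto
      finally have "(\<Sum>i\<in>B' - B. u i - u (\<rho> i)) \<ge> sum u (B' - B) - sum u (B - B')"
        by (simp add: sum_subtractf)
      moreover have "(\<Sum>i\<in>B' - B. u i - u (\<rho> i)) \<le> ?d"
        by (intro sum_mono) (simp add: d_def)
      moreover have "sum u B' = sum u (B' \<inter> B) + sum u (B' - B)" "sum u B = sum u (B \<inter> B') + sum u (B - B')"
        using fB fB' by (simp_all add: sum.Int_Diff[symmetric])
      ultimately show ?thesis by (simp add: w_def Int_commute)
    qed
    then have "f B' \<le> h (w + ?d)"
      using f[OF B'N] h_mono[of "sum u B'" "w + ?d"] u B'N by (simp add: h_def sum_nonneg subset_iff)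
    also have "\<dots> = h w + (\<Sum>i\<in>B' - B. d i / ((1 + w) * (1 + w + ?d)))"
      using h_diff[OF d0'] by (simp add: sum_divide_distrib)
    also have "(\<Sum>i\<in>B' - B. d i / ((1 + w) * (1 + w + ?d))) \<le> (\<Sum>i\<in>B' - B. h (w + d i) - h w)"
    proof (rule sum_mono)
      fix i assume i: "i \<in> B' - B"
      have "d i \<le> ?d" using i fB' d0 by (intro member_le_sum) auto
      then show "d i / ((1 + w) * (1 + w + ?d)) \<le> h (w + d i) - h w"
        unfolding h_diff[OF d0] using w0 d0[of i] by (intro divide_left_mono mult_left_mono) auto
    qed
    also have "\<dots> \<le> (\<Sum>i\<in>T. capped f k (insert i S) - capped f k S)"
      by (rule sum_gain_le_sum_capped_gain[OF S T _ gain]) (use B' in auto)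
    finally show ?thesis using fS B'(3) by simp
  qed
qed

end

section \<open>Runs of a policy\<close>

lemma expectation_single: "measure_pmf.expectation p (\<lambda>y. of_bool (y = z) :: real) = pmf p z"
proof -
  have "(\<lambda>y. of_bool (y = z) :: real) = indicator {z}" by (auto simp: indicator_def)
  then show ?thesis by (simp add: measure_pmf_single)
qed

lemma sum_pmf_Some_le_1: "finite B \<Longrightarrow> (\<Sum>b\<in>B. pmf p (Some b)) \<le> 1"
proof -
  assume B: "finite B"
  have "(\<Sum>b\<in>B. pmf p (Some b)) = measure_pmf.prob p (Some ` B)"
    using B by (simp add: measure_measure_pmf_finite sum.reindex)
  then show ?thesis by simp
qed

lemma processed_Nil [simp]: "processed [] = {}"
  by (simp add: processed_def)

lemma processed_snoc [simp]: "processed (h @ [(x, ch)]) = processed h \<union> dom x"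
  by (auto simp: processed_def)

lemma chose_Nil [simp]: "\<not> chose [] a b"
  by (simp add: chose_def)

lemma chose_snoc [simp]:
  "chose (h @ [(x, ch)]) a b \<longleftrightarrow> chose h a b \<or> a \<in> dom x \<and> ch a = Some b"
  by (auto simp: chose_def)

lemma chose_processed: "chose h a b \<Longrightarrow> a \<in> processed h"
  by (auto simp: chose_def processed_def)

text \<open>
  A union rather than a choice, so that it is defined on every history: in a run of an admissible
  policy each agent occurs at most once, and an agent that has not been processed yet gets \<open>{}\<close>.
\<close>

definition shown :: "'a history \<Rightarrow> 'a \<Rightarrow> 'a set" where
  "shown h a = (\<Union>(x, ch)\<in>{s \<in> set h. a \<in> dom (fst s)}. the (x a))"

lemma shown_Nil [simp]: "shown [] a = {}"
  by (simp add: shown_def)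

lemma shown_snoc [simp]:
  "shown (h @ [(x, ch)]) a = (if a \<in> dom x then shown h a \<union> the (x a) else shown h a)"
  by (auto simp: shown_def)

lemma shown_unprocessed: "a \<notin> processed h \<Longrightarrow> shown h a = {}"
  by (auto simp: shown_def processed_def)

lemma reachable_induct [consumes 1, case_names Nil snoc]:
  assumes "h \<in> set_pmf (run I \<pi> n)"
    and "P []"
    and "\<And>h x ch. possible I \<pi> h x \<Longrightarrow> P h \<Longrightarrow> ch \<in> set_pmf (choices I x) \<Longrightarrow> P (h @ [(x, ch)])"
  shows "P h"
  using assms(1)
proof (induction n arbitrary: h)
  case 0
  then show ?case using assms(2) by simp
next
  case (Suc n)
  then obtain h' where h': "h' \<in> set_pmf (run I \<pi> n)" "h \<in> set_pmf (policy_step I \<pi> h')"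
    by auto
  show ?case
  proof (cases "agents I \<subseteq> processed h'")
    case True
    then show ?thesis using h' Suc.IH by (simp add: policy_step_def)
  next
    case False
    then obtain x ch where "x \<in> set_pmf (\<pi> h')" "h = h' @ [(x, ch)]" "ch \<in> set_pmf (choices I x)"
      using h'(2) by (auto simp: policy_step_def)
    then show ?thesis
      using h'(1) False assms(3)[of h' x ch] Suc.IH[OF h'(1)] by (auto simp: possible_def)
  qed
qed

lemma num_matches_le:
  assumes "finite (Customers I)" "finite (Suppliers I)"
  shows "num_matches I h \<le> card (Customers I) * card (Suppliers I)"
  unfolding num_matches_def card_cartesian_product[symmetric]
  using assms by (intro card_mono) auto

lemma expected_matches_le:
  assumes "finite (Customers I)" "finite (Suppliers I)"
  shows "expected_matches I \<pi> \<le> real (card (Customers I) * card (Suppliers I))"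
  unfolding expected_matches_def
  using num_matches_le[OF assms]
  by (intro measure_pmf.integral_le_const measure_pmf.integrable_const_bound[where B = "real (card (Customers I) * card (Suppliers I))"])
     (auto simp del: of_nat_mult)

text \<open>
  The initiating side is called \<open>D\<close> and the responding side \<open>R\<close>; which one are the customers is left
  open, so that every statement covers both cases.
\<close>

locale two_sides =
  fixes I :: "'a market" and D R :: "'a set"
  assumes valid: "valid_market I" and regular: "regular I"
    and sides: "D = Customers I \<and> R = Suppliers I \<or> D = Suppliers I \<and> R = Customers I"
begin

lemma finite_sides [simp]: "finite D" "finite R"
  and disjoint: "D \<inter> R = {}"
  and nonempty: "D \<noteq> {}" "R \<noteq> {}"
  and agents: "agents I = D \<union> R"
  using valid sides by (auto simp: valid_market_def agents_def)

lemma opposite_D: "i \<in> D \<Longrightarrow> opposite I i = R"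
  and opposite_R: "j \<in> R \<Longrightarrow> opposite I j = D"
  using sides disjoint by (auto simp: opposite_def)

lemma Choice_support:
  "a \<in> D \<union> R \<Longrightarrow> B \<subseteq> opposite I a \<Longrightarrow> set_pmf (Choice I a B) \<subseteq> insert None (Some ` B)"
  using valid by (auto simp: valid_market_def agents)

lemma pmf_Choice_zero:
  assumes "a \<in> D \<union> R" "B \<subseteq> opposite I a" "b \<notin> B"
  shows "pmf (Choice I a B) (Some b) = 0"
proof -
  have "Some b \<notin> set_pmf (Choice I a B)"
    using Choice_support[OF assms(1,2)] assms(3) by blast
  then show ?thesis by (simp add: set_pmf_iff)
qed

lemma opposite_subset: "a \<in> D \<union> R \<Longrightarrow> opposite I a \<subseteq> D \<union> R"
  using opposite_D opposite_R by auto

lemma finite_opposite: "a \<in> D \<union> R \<Longrightarrow> finite (opposite I a)"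
  using opposite_subset finite_subset by (metis finite_UnI finite_sides)

lemma demand_monotone_submodular:
  assumes "j \<in> R"
  shows "monotone_submodular D (demand I j)"
  using valid assms opposite_R[OF assms]
  by unfold_locales (auto simp: valid_market_def agents demand_def)

abbreviation best_value :: "('a \<Rightarrow> enat) \<Rightarrow> 'a \<Rightarrow> 'a set \<Rightarrow> real" where
  "best_value \<kappa> j \<equiv> capped (demand I j) (\<kappa> j)"

definition backlog :: "'a history \<Rightarrow> 'a \<Rightarrow> 'a set" where
  "backlog h j = {i\<in>D. chose h i j}"

lemma backlog_subset: "backlog h j \<subseteq> D"
  by (auto simp: backlog_def)

lemma finite_backlog [simp]: "finite (backlog h j)"
  by (simp add: backlog_def)

definition matches :: "'a history \<Rightarrow> 'a \<Rightarrow> nat" where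
  "matches h j = card {i\<in>backlog h j. chose h j i}"

lemma num_matches_eq: "num_matches I h = (\<Sum>j\<in>R. matches h j)"
proof -
  let ?A = "SIGMA j:R. {i\<in>backlog h j. chose h j i}"
  have "num_matches I h = card ?A"
  proof (cases "D = Customers I \<and> R = Suppliers I")
    case True
    then have "{(c, s). c \<in> Customers I \<and> s \<in> Suppliers I \<and> chose h c s \<and> chose h s c} = prod.swap ` ?A"
      unfolding backlog_def by (auto simp: image_iff)
    then show ?thesis by (simp add: num_matches_def card_image)
  next
    case False
    then have "{(c, s). c \<in> Customers I \<and> s \<in> Suppliers I \<and> chose h c s \<and> chose h s c} = ?A"
      using sides unfolding backlog_def by auto
    then show ?thesis by (simp add: num_matches_def)
  qed
  also have "\<dots> = (\<Sum>j\<in>R. matches h j)"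
    by (simp add: matches_def)
  finally show ?thesis .
qed

context
  fixes \<kappa> :: "'a \<Rightarrow> enat" and \<pi> :: "'a policy"
  assumes adm: "admissible I \<kappa> \<pi>"
begin

lemma possible_action:
  assumes "possible I \<pi> h x"
  shows "dom x \<noteq> {}" "dom x \<subseteq> (D \<union> R) - processed h"
    and "a \<in> dom x \<Longrightarrow> the (x a) \<subseteq> opposite I a"
    and "a \<in> dom x \<Longrightarrow> enat (card (the (x a))) \<le> \<kappa> a"
    and "finite (dom x)"
proof -
  show "dom x \<noteq> {}" "dom x \<subseteq> (D \<union> R) - processed h"
    "a \<in> dom x \<Longrightarrow> the (x a) \<subseteq> opposite I a" "a \<in> dom x \<Longrightarrow> enat (card (the (x a))) \<le> \<kappa> a"
    using adm assms by (auto simp: admissible_def agents)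
  then show "finite (dom x)"
    by (meson Diff_subset finite_UnI finite_sides finite_subset)
qed

lemma finite_policy:
  assumes "h \<in> set_pmf (run I \<pi> n)" "\<not> agents I \<subseteq> processed h"
  shows "finite (set_pmf (\<pi> h))"
proof (rule finite_subset)
  have "dom x \<subseteq> D \<union> R \<and> ran x \<subseteq> Pow (D \<union> R)" if "x \<in> set_pmf (\<pi> h)" for x
  proof -
    have p: "possible I \<pi> h x" using that assms by (auto simp: possible_def)
    have "B \<subseteq> D \<union> R" if "x a = Some B" for a B
    proof -
      have a: "a \<in> dom x" using that by auto
      then have "a \<in> D \<union> R" using possible_action(2)[OF p] by blast
      with possible_action(3)[OF p a] opposite_subset[of a] that show ?thesis by simp
    qed
    then show ?thesis using possible_action(2)[OF p] by (auto simp: ran_def)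
  qed
  then show "set_pmf (\<pi> h) \<subseteq> (\<Union>A\<in>Pow (D \<union> R). {x. dom x = A \<and> ran x \<subseteq> Pow (D \<union> R)})"
    by auto
  show "finite (\<Union>A\<in>Pow (D \<union> R). {x. dom x = A \<and> ran x \<subseteq> Pow (D \<union> R)})"
    by (intro finite_UN_I finite_set_of_finite_maps) (auto intro: finite_subset)
qed

lemma finite_choices:
  assumes "possible I \<pi> h x"
  shows "finite (set_pmf (choices I x))"
proof -
  note x = possible_action[OF assms]
  have "finite (set_pmf (Choice I a (the (x a))))" if "a \<in> dom x" for a
  proof (rule finite_subset[OF Choice_support])
    show "a \<in> D \<union> R" using x(2) that by auto
    show "the (x a) \<subseteq> opposite I a" using x(3) that by auto
    then show "finite (insert None (Some ` the (x a)))"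
      using finite_opposite[OF \<open>a \<in> D \<union> R\<close>] finite_subset by auto
  qed
  then show ?thesis
    unfolding choices_def set_Pi_pmf[OF x(5)] comp_def by (intro finite_PiE_dflt x(5))
qed

lemma finite_run: "finite (set_pmf (run I \<pi> n))"
proof (induction n)
  case (Suc n)
  have "finite (set_pmf (policy_step I \<pi> h))" if "h \<in> set_pmf (run I \<pi> n)" for h
    using that finite_policy[OF that] finite_choices[of h]
    by (auto simp: policy_step_def possible_def)
  with Suc show ?case by simp
qed simp

text \<open>
  A functional of the history that does not increase in expectation in any step of the policy does
  not increase along the run either. All expectations about runs below come from this principle.
\<close>

lemma expectation_run_step:
  assumes step: "\<And>h x. h \<in> set_pmf (run I \<pi> n) \<Longrightarrow> possible I \<pi> h x \<Longrightarrow>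
      measure_pmf.expectation (choices I x) (\<lambda>ch. F (h @ [(x, ch)])) \<le> (F h :: real)"
  shows "measure_pmf.expectation (run I \<pi> (Suc n)) F \<le> measure_pmf.expectation (run I \<pi> n) F"
proof -
  have fin: "finite (set_pmf (bind_pmf (run I \<pi> n) (policy_step I \<pi>)))"
    using finite_run[of "Suc n"] by simp
  have "measure_pmf.expectation (run I \<pi> (Suc n)) F =
      measure_pmf.expectation (run I \<pi> n) (\<lambda>h. measure_pmf.expectation (policy_step I \<pi> h) F)"
    using expectation_bind_pmf_finite[OF fin] by simp
  also have "\<dots> \<le> measure_pmf.expectation (run I \<pi> n) F"
  proof (intro integral_mono_AE integrable_measure_pmf_finite finite_run AE_pmfI)
    fix h assume h: "h \<in> set_pmf (run I \<pi> n)"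
    show "measure_pmf.expectation (policy_step I \<pi> h) F \<le> F h"
    proof (cases "agents I \<subseteq> processed h")
      case False
      let ?q = "\<lambda>x. map_pmf (\<lambda>ch. h @ [(x, ch)]) (choices I x)"
      have "set_pmf (policy_step I \<pi> h) \<subseteq> set_pmf (bind_pmf (run I \<pi> n) (policy_step I \<pi>))"
        using h by auto
      with fin have "finite (set_pmf (policy_step I \<pi> h))"
        using finite_subset by blast
      then have fin': "finite (set_pmf (bind_pmf (\<pi> h) ?q))"
        using False by (simp add: policy_step_def)
      have "measure_pmf.expectation (policy_step I \<pi> h) F =
          measure_pmf.expectation (\<pi> h) (\<lambda>x. measure_pmf.expectation (?q x) F)"
        using False expectation_bind_pmf_finite[OF fin'] by (simp add: policy_step_def)
      also have "\<dots> \<le> measure_pmf.expectation (\<pi> h) (\<lambda>x. F h)"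
        using finite_policy[OF h False] step[OF h] h False
        by (intro integral_mono_AE integrable_measure_pmf_finite AE_pmfI) (auto simp: possible_def)
      finally show ?thesis by simp
    qed (simp add: policy_step_def)
  qed
  finally show ?thesis .
qed

lemma run_supermartingale:
  assumes step: "\<And>h x. possible I \<pi> h x \<Longrightarrow>
      measure_pmf.expectation (choices I x) (\<lambda>ch. F (h @ [(x, ch)])) \<le> (F h :: real)"
  shows "measure_pmf.expectation (run I \<pi> n) F \<le> F []"
proof (induction n)
  case (Suc n)
  then show ?case using expectation_run_step[of n F] step by fastforce
qed simp

lemma run_submartingale:
  assumes step: "\<And>h x. possible I \<pi> h x \<Longrightarrow>
      (F h :: real) \<le> measure_pmf.expectation (choices I x) (\<lambda>ch. F (h @ [(x, ch)]))"
  shows "F [] \<le> measure_pmf.expectation (run I \<pi> n) F"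
  using run_supermartingale[of "\<lambda>h. - F h" n] step by simp

lemma integrable_run: "integrable (run I \<pi> n) (f :: _ \<Rightarrow> real)"
  by (intro integrable_measure_pmf_finite finite_run)

lemma expectation_choices:
  assumes "possible I \<pi> h x" "a \<in> dom x"
  shows "measure_pmf.expectation (choices I x) (\<lambda>ch. f (ch a) :: real) =
           measure_pmf.expectation (Choice I a (the (x a))) f"
proof -
  have "measure_pmf.expectation (choices I x) (\<lambda>ch. f (ch a)) =
      measure_pmf.expectation (map_pmf (\<lambda>ch. ch a) (choices I x)) f"
    by simp
  then show ?thesis
    unfolding choices_def
    using assms(2) by (simp only: Pi_pmf_component[OF possible_action(5)[OF assms(1)]] if_True)
qed

text \<open>
  The difference of the two integrands is a martingale: it is 0 until \<open>i\<close> is processed, and in that step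
  the choice of \<open>i\<close> is drawn from the choice model for the assortment shown. However adaptively the
  assortment is selected, only its distribution enters.
\<close>

lemma expectation_chose:
  assumes i: "i \<in> D"
  shows "measure_pmf.prob (run I \<pi> n) {h. chose h i j} =
           measure_pmf.expectation (run I \<pi> n) (\<lambda>h. pmf (Choice I i (shown h i)) (Some j))"
proof -
  define F where "F h = of_bool (chose h i j) - pmf (Choice I i (shown h i)) (Some j)" for h
  have F0: "F [] = 0"
    using pmf_Choice_zero[of i "{}" j] i by (simp add: F_def)
  have "measure_pmf.expectation (choices I x) (\<lambda>ch. F (h @ [(x, ch)])) = F h"
    if p: "possible I \<pi> h x" for h x
  proof (cases "i \<in> dom x")
    case False
    then show ?thesis by (simp add: F_def)
  next
    case True
    then have "i \<notin> processed h" using possible_action(2)[OF p] by auto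
    then have h: "\<not> chose h i j" "shown h i = {}"
      using chose_processed shown_unprocessed by metis+
    have "measure_pmf.expectation (choices I x) (\<lambda>ch. F (h @ [(x, ch)])) =
        measure_pmf.expectation (choices I x)
          (\<lambda>ch. of_bool (ch i = Some j) - pmf (Choice I i (the (x i))) (Some j))"
      using True h by (simp add: F_def)
    also have "\<dots> = measure_pmf.expectation (choices I x) (\<lambda>ch. of_bool (ch i = Some j)) -
        pmf (Choice I i (the (x i))) (Some j)"
      by (simp add: integrable_measure_pmf_finite[OF finite_choices[OF p]])
    also have "\<dots> = 0"
      using expectation_choices[OF p True, of "\<lambda>y. of_bool (y = Some j)"]
      by (simp add: expectation_single)
    also have "0 = F h"
      using h pmf_Choice_zero[of i "{}" j] i by (simp add: F_def)
    finally show ?thesis .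
  qed
  then have "measure_pmf.expectation (run I \<pi> n) F = 0"
    using run_supermartingale[of F n] run_submartingale[of F n] F0 by simp
  moreover have "measure_pmf.expectation (run I \<pi> n) F =
      measure_pmf.prob (run I \<pi> n) {h. chose h i j} -
      measure_pmf.expectation (run I \<pi> n) (\<lambda>h. pmf (Choice I i (shown h i)) (Some j))"
  proof -
    have "(\<lambda>h. of_bool (chose h i j)) = (indicator {h. chose h i j} :: _ \<Rightarrow> real)"
      by (auto simp: indicator_def)
    then show ?thesis unfolding F_def by (simp add: integrable_run)
  qed
  ultimately show ?thesis by simp
qed

lemma shown_action:
  assumes "h \<in> set_pmf (run I \<pi> n)" "a \<in> D \<union> R"
  shows "shown h a \<subseteq> opposite I a \<and> enat (card (shown h a)) \<le> \<kappa> a"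
  using assms(1)
proof (induction rule: reachable_induct)
  case Nil
  then show ?case by (simp add: zero_enat_def[symmetric])
next
  case (snoc h x ch)
  note x = possible_action[OF snoc(1)]
  show ?case
  proof (cases "a \<in> dom x")
    case True
    then have "shown h a = {}" using x(2) by (intro shown_unprocessed) auto
    then show ?thesis using True x(3,4)[OF True] by simp
  qed (use snoc in simp)
qed

text \<open>
  Every step processes at least one new agent.
\<close>

lemma run_complete:
  assumes "h \<in> set_pmf (run I \<pi> n)"
  shows "agents I \<subseteq> processed h \<or> n \<le> card (processed h) \<and> processed h \<subseteq> agents I"
  using assms
proof (induction n arbitrary: h)
  case 0
  then show ?case by simp
next
  case (Suc n)
  then obtain h' where h': "h' \<in> set_pmf (run I \<pi> n)" "h \<in> set_pmf (policy_step I \<pi> h')"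
    by auto
  show ?case
  proof (cases "agents I \<subseteq> processed h'")
    case True
    then show ?thesis using h' by (simp add: policy_step_def)
  next
    case False
    then obtain x ch where x: "x \<in> set_pmf (\<pi> h')" and h: "h = h' @ [(x, ch)]"
      using h'(2) by (auto simp: policy_step_def)
    have p: "possible I \<pi> h' x" using h' x False by (auto simp: possible_def)
    note x = possible_action[OF p]
    have IH: "n \<le> card (processed h')" "processed h' \<subseteq> D \<union> R"
      using Suc.IH[OF h'(1)] False by (auto simp: agents)
    then have "finite (processed h')" by (meson finite_UnI finite_sides finite_subset)
    then have "card (processed h) = card (processed h') + card (dom x)"
      using x(2,5) by (auto simp: h intro!: card_Un_disjoint)
    moreover have "card (dom x) > 0" using x(1,5) by (simp add: card_gt_0_iff)
    ultimately show ?thesis using IH x(2) by (auto simp: h agents)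
  qed
qed

lemma run_finished:
  assumes "h \<in> set_pmf (run I \<pi> (card (agents I)))"
  shows "agents I \<subseteq> processed h"
  using run_complete[OF assms] card_seteq[of "agents I" "processed h"] by (auto simp: agents)

text \<open>
  Members of the offer \<open>B\<close> outside the backlog \<open>C\<close> cannot match. By regularity, omitting them does not
  make any other member less likely to be chosen.
\<close>

lemma response_le_value:
  assumes j: "j \<in> R" and C: "C \<subseteq> D" and B: "B \<subseteq> D" "enat (card B) \<le> \<kappa> j"
  shows "(\<Sum>i\<in>C. pmf (Choice I j B) (Some i)) \<le> best_value \<kappa> j C"
proof -
  have fin: "finite C" "finite B" using C B by (auto intro: finite_subset)
  have "(\<Sum>i\<in>C. pmf (Choice I j B) (Some i)) = (\<Sum>i\<in>C \<inter> B. choice_prob I j i B)"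
    unfolding choice_prob_def
    by (intro sum.mono_neutral_right) (use fin pmf_Choice_zero[of j B] j B opposite_R[OF j] in auto)
  also have "\<dots> \<le> (\<Sum>i\<in>C \<inter> B. choice_prob I j i (C \<inter> B))"
    using regular j B(1) opposite_R[OF j] by (intro sum_mono) (auto simp: regular_def agents)
  also have "\<dots> = demand I j (C \<inter> B)" by (simp add: demand_def)
  also have "\<dots> \<le> best_value \<kappa> j C"
  proof (rule capped_upper)
    have "enat (card (C \<inter> B)) \<le> enat (card B)" using fin by (simp add: card_mono)
    then show "enat (card (C \<inter> B)) \<le> \<kappa> j" using B(2) by (rule order_trans)
  qed (use fin in auto)
  finally show ?thesis .
qed

context
  assumes one_sided: "\<And>h x. possible I \<pi> h x \<Longrightarrow> \<not> D \<subseteq> processed h \<Longrightarrow> dom x \<subseteq> D"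
begin

lemma responders_last:
  assumes "h \<in> set_pmf (run I \<pi> n)" "j \<in> R" "j \<in> processed h"
  shows "D \<subseteq> processed h"
  using assms(1,3)
proof (induction rule: reachable_induct)
  case (snoc h x ch)
  then show ?case using one_sided[OF snoc(1)] disjoint \<open>j \<in> R\<close> by auto
qed simp

text \<open>
  The matches of \<open>j\<close> beyond the value of its backlog, counted from the moment when \<open>j\<close> responds. Before
  that moment it is 0, so that it stays constant while the backlog grows.
\<close>

definition excess :: "'a history \<Rightarrow> 'a \<Rightarrow> real" where
  "excess h j = (if j \<in> processed h then real (matches h j) - best_value \<kappa> j (backlog h j) else 0)"

text \<open>
  In a one-sided run the backlog of \<open>j\<close> is final when \<open>j\<close> is processed. The expected number of matches
  of \<open>j\<close>, given the history, is then the probability that \<open>j\<close> chooses a member of its backlog.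
\<close>

lemma expectation_excess:
  assumes p: "possible I \<pi> h x" and j: "j \<in> R"
  shows "measure_pmf.expectation (choices I x) (\<lambda>ch. excess (h @ [(x, ch)]) j) =
      (if j \<in> dom x then (\<Sum>i\<in>backlog h j. pmf (Choice I j (the (x j))) (Some i)) - best_value \<kappa> j (backlog h j)
       else excess h j)"
proof -
  note x = possible_action[OF p]
  have same: "backlog (h @ [(x, ch)]) j = backlog h j" if "D \<subseteq> processed h" for ch
    using that x(2) by (auto simp: backlog_def)
  show ?thesis
  proof (cases "j \<in> dom x")
    case False
    have "excess (h @ [(x, ch)]) j = excess h j" for ch
    proof (cases "j \<in> processed h")
      case True
      then have "D \<subseteq> processed h"
        using responders_last j p by (auto simp: possible_def)
      from same[OF this] True False show ?thesis
        by (simp add: excess_def matches_def)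
    qed (use False in \<open>simp add: excess_def\<close>)
    then show ?thesis using False by simp
  next
    case True
    then have D: "D \<subseteq> processed h" using one_sided[OF p] disjoint j by auto
    have "j \<notin> processed h" using True x(2) by auto
    then have nc: "\<not> chose h j i" for i using chose_processed by metis
    have "excess (h @ [(x, ch)]) j = (\<Sum>i\<in>backlog h j. of_bool (ch j = Some i)) - best_value \<kappa> j (backlog h j)" for ch
      using True same[OF D] nc
      by (simp add: excess_def matches_def flip: sum.inter_filter) (simp add: Int_def)
    then have "measure_pmf.expectation (choices I x) (\<lambda>ch. excess (h @ [(x, ch)]) j) =
        measure_pmf.expectation (choices I x)
          (\<lambda>ch. (\<Sum>i\<in>backlog h j. of_bool (ch j = Some i)) - best_value \<kappa> j (backlog h j))"
      by simp
    also have "\<dots> = measure_pmf.expectation (choices I x)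
          (\<lambda>ch. (\<Sum>i\<in>backlog h j. of_bool (ch j = Some i))) - best_value \<kappa> j (backlog h j)"
      by (subst Bochner_Integration.integral_diff)
         (auto intro!: integrable_measure_pmf_finite[OF finite_choices[OF p]])
    also have "measure_pmf.expectation (choices I x) (\<lambda>ch. (\<Sum>i\<in>backlog h j. of_bool (ch j = Some i) :: real))
        = (\<Sum>i\<in>backlog h j. measure_pmf.expectation (choices I x) (\<lambda>ch. of_bool (ch j = Some i)))"
      by (rule Bochner_Integration.integral_sum)
         (auto intro!: integrable_measure_pmf_finite[OF finite_choices[OF p]])
    also have "\<dots> = (\<Sum>i\<in>backlog h j. pmf (Choice I j (the (x j))) (Some i))"
      using expectation_choices[OF p True, of "\<lambda>y. of_bool (y = Some _)"]
      by (simp add: expectation_single)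
    finally show ?thesis using True by simp
  qed
qed

lemma expected_matches_eq:
  "expected_matches I \<pi> = (\<Sum>j\<in>R. measure_pmf.expectation (run I \<pi> (card (agents I))) (\<lambda>h. best_value \<kappa> j (backlog h j)) +
      measure_pmf.expectation (run I \<pi> (card (agents I))) (\<lambda>h. excess h j))"
proof -
  let ?E = "measure_pmf.expectation (run I \<pi> (card (agents I)))"
  have "expected_matches I \<pi> = (\<Sum>j\<in>R. ?E (\<lambda>h. real (matches h j)))"
    by (simp add: expected_matches_def num_matches_eq integrable_run)
  also have "\<dots> = (\<Sum>j\<in>R. ?E (\<lambda>h. best_value \<kappa> j (backlog h j) + excess h j))"
  proof (intro sum.cong refl integral_cong_AE AE_pmfI)
    fix j h assume "j \<in> R" "h \<in> set_pmf (run I \<pi> (card (agents I)))"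
    then have "j \<in> processed h" using run_finished agents by auto
    then show "real (matches h j) = best_value \<kappa> j (backlog h j) + excess h j"
      by (simp add: excess_def)
  qed auto
  finally show ?thesis by (simp add: integrable_run)
qed

lemma expected_matches_le_value:
  "expected_matches I \<pi> \<le>
     (\<Sum>j\<in>R. measure_pmf.expectation (run I \<pi> (card (agents I))) (\<lambda>h. best_value \<kappa> j (backlog h j)))"
  unfolding expected_matches_eq
proof (rule sum_mono)
  fix j assume j: "j \<in> R"
  have "measure_pmf.expectation (run I \<pi> (card (agents I))) (\<lambda>h. excess h j) \<le> excess [] j"
  proof (rule run_supermartingale)
    fix h x assume p: "possible I \<pi> h x"
    have "j \<in> dom x \<Longrightarrow> j \<notin> processed h" using possible_action(2)[OF p] by auto
    moreover have "(\<Sum>i\<in>backlog h j. pmf (Choice I j (the (x j))) (Some i)) \<le> best_value \<kappa> j (backlog h j)"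
      if "j \<in> dom x"
      using response_le_value[OF j backlog_subset] possible_action(3,4)[OF p that] opposite_R[OF j]
      by simp
    ultimately show "measure_pmf.expectation (choices I x) (\<lambda>ch. excess (h @ [(x, ch)]) j) \<le> excess h j"
      unfolding expectation_excess[OF p j] by (simp add: excess_def)
  qed
  then show "measure_pmf.expectation (run I \<pi> (card (agents I))) (\<lambda>h. best_value \<kappa> j (backlog h j)) +
      measure_pmf.expectation (run I \<pi> (card (agents I))) (\<lambda>h. excess h j)
      \<le> measure_pmf.expectation (run I \<pi> (card (agents I))) (\<lambda>h. best_value \<kappa> j (backlog h j))"
    by (simp add: excess_def)
qed

lemma expected_matches_ge_value:
  assumes best: "\<And>h x j. possible I \<pi> h x \<Longrightarrow> j \<in> R \<Longrightarrow> j \<in> dom x \<Longrightarrow>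
      the (x j) \<subseteq> backlog h j \<and> demand I j (the (x j)) = best_value \<kappa> j (backlog h j)"
  shows "(\<Sum>j\<in>R. measure_pmf.expectation (run I \<pi> (card (agents I))) (\<lambda>h. best_value \<kappa> j (backlog h j)))
      \<le> expected_matches I \<pi>"
  unfolding expected_matches_eq
proof (rule sum_mono)
  fix j assume j: "j \<in> R"
  have "excess [] j \<le> measure_pmf.expectation (run I \<pi> (card (agents I))) (\<lambda>h. excess h j)"
  proof (rule run_submartingale)
    fix h x assume p: "possible I \<pi> h x"
    have np: "j \<in> dom x \<Longrightarrow> j \<notin> processed h" using possible_action(2)[OF p] by auto
    have "best_value \<kappa> j (backlog h j) \<le> (\<Sum>i\<in>backlog h j. pmf (Choice I j (the (x j))) (Some i))"
      if "j \<in> dom x"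
    proof -
      note b = best[OF p j that]
      have "best_value \<kappa> j (backlog h j) = (\<Sum>i\<in>the (x j). pmf (Choice I j (the (x j))) (Some i))"
        using b by (simp add: demand_def choice_prob_def)
      also have "\<dots> \<le> (\<Sum>i\<in>backlog h j. pmf (Choice I j (the (x j))) (Some i))"
        using b by (intro sum_mono2) auto
      finally show ?thesis .
    qed
    then show "excess h j \<le> measure_pmf.expectation (choices I x) (\<lambda>ch. excess (h @ [(x, ch)]) j)"
      using np unfolding expectation_excess[OF p j] by (simp add: excess_def)
  qed
  then show "measure_pmf.expectation (run I \<pi> (card (agents I))) (\<lambda>h. best_value \<kappa> j (backlog h j))
      \<le> measure_pmf.expectation (run I \<pi> (card (agents I))) (\<lambda>h. best_value \<kappa> j (backlog h j)) +
      measure_pmf.expectation (run I \<pi> (card (agents I))) (\<lambda>h. excess h j)"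
    by (simp add: excess_def)
qed

end

end

end

section \<open>From adaptive to static policies\<close>

context two_sides
begin

definition best_response :: "('a \<Rightarrow> enat) \<Rightarrow> 'a \<Rightarrow> 'a set \<Rightarrow> 'a set" where
  "best_response \<kappa> j C =
     (SOME B. B \<subseteq> C \<and> enat (card B) \<le> \<kappa> j \<and> demand I j B = best_value \<kappa> j C)"

lemma best_response:
  assumes "finite C"
  shows "best_response \<kappa> j C \<subseteq> C" "enat (card (best_response \<kappa> j C)) \<le> \<kappa> j"
    "demand I j (best_response \<kappa> j C) = best_value \<kappa> j C"
proof -
  have "\<exists>B. B \<subseteq> C \<and> enat (card B) \<le> \<kappa> j \<and> demand I j B = best_value \<kappa> j C"
    using capped_attained[OF assms] by metis
  from someI_ex[OF this] show "best_response \<kappa> j C \<subseteq> C" "enat (card (best_response \<kappa> j C)) \<le> \<kappa> j"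
    "demand I j (best_response \<kappa> j C) = best_value \<kappa> j C"
    by (auto simp: best_response_def)
qed

definition respond :: "('a \<Rightarrow> enat) \<Rightarrow> 'a history \<Rightarrow> 'a action" where
  "respond \<kappa> h = (\<lambda>j. if j \<in> R - processed h then Some (best_response \<kappa> j (backlog h j)) else None)"

definition two_phase :: "('a \<Rightarrow> enat) \<Rightarrow> 'a policy \<Rightarrow> 'a policy" where
  "two_phase \<kappa> \<sigma> h = (if D \<subseteq> processed h then return_pmf (respond \<kappa> h) else \<sigma> h)"

text \<open>
  Demanded on all histories, reachable or not, so that it can be verified without describing the runs of
  the policy.
\<close>

definition initiating :: "('a \<Rightarrow> enat) \<Rightarrow> 'a policy \<Rightarrow> bool" where
  "initiating \<kappa> \<sigma> \<longleftrightarrow> (\<forall>h. \<not> D \<subseteq> processed h \<longrightarrow> (\<forall>x\<in>set_pmf (\<sigma> h).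
     dom x \<noteq> {} \<and> dom x \<subseteq> D - processed h \<and>
     (\<forall>i\<in>dom x. the (x i) \<subseteq> R \<and> enat (card (the (x i))) \<le> \<kappa> i)))"

lemma dom_respond: "dom (respond \<kappa> h) = R - processed h"
  by (auto simp: respond_def dom_def)

lemma two_phase_admissible:
  assumes "initiating \<kappa> \<sigma>"
  shows "admissible I \<kappa> (two_phase \<kappa> \<sigma>)"
  unfolding admissible_def
proof (intro allI impI)
  fix h x assume p: "possible I (two_phase \<kappa> \<sigma>) h x"
  show "dom x \<noteq> {} \<and> dom x \<subseteq> agents I - processed h \<and>
        (\<forall>a\<in>dom x. the (x a) \<subseteq> opposite I a \<and> enat (card (the (x a))) \<le> \<kappa> a)"
  proof (cases "D \<subseteq> processed h")
    case True
    then have x: "x = respond \<kappa> h" using p by (simp add: possible_def two_phase_def)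
    have "R - processed h \<noteq> {}" using True p by (auto simp: possible_def agents)
    moreover have "the (x j) = best_response \<kappa> j (backlog h j)" if "j \<in> dom x" for j
      using that unfolding x dom_respond by (simp add: respond_def)
    moreover have "best_response \<kappa> j (backlog h j) \<subseteq> D" for j
      using best_response(1)[OF finite_backlog] backlog_subset by (metis order_trans)
    moreover have "dom x = R - processed h" unfolding x dom_respond ..
    ultimately show ?thesis
      using best_response(2)[OF finite_backlog] opposite_R by (auto simp: agents)
  next
    case False
    then have x: "x \<in> set_pmf (\<sigma> h)" using p by (simp add: possible_def two_phase_def)
    from assms False x have "dom x \<noteq> {}" "dom x \<subseteq> D - processed h"
      "\<forall>i\<in>dom x. the (x i) \<subseteq> R \<and> enat (card (the (x i))) \<le> \<kappa> i"
      by (auto simp: initiating_def)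
    then show ?thesis using opposite_D by (auto simp: agents)
  qed
qed

lemma two_phase_one_sided:
  assumes "initiating \<kappa> \<sigma>" "possible I (two_phase \<kappa> \<sigma>) h x" "\<not> D \<subseteq> processed h"
  shows "dom x \<subseteq> D"
  using assms by (auto simp: possible_def two_phase_def initiating_def)

lemma two_phase_value:
  assumes "initiating \<kappa> \<sigma>"
  shows "(\<Sum>j\<in>R. measure_pmf.expectation (run I (two_phase \<kappa> \<sigma>) (card (agents I)))
             (\<lambda>h. best_value \<kappa> j (backlog h j)))
      \<le> expected_matches I (two_phase \<kappa> \<sigma>)"
proof (rule expected_matches_ge_value[OF two_phase_admissible[OF assms]])
  fix h x j assume p: "possible I (two_phase \<kappa> \<sigma>) h x" and j: "j \<in> R" "j \<in> dom x"
  then have "D \<subseteq> processed h" using two_phase_one_sided[OF assms p] disjoint by auto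
  then have x: "x = respond \<kappa> h" using p by (simp add: possible_def two_phase_def)
  then have "the (x j) = best_response \<kappa> j (backlog h j)"
    using j(2) unfolding x dom_respond by (simp add: respond_def)
  then show "the (x j) \<subseteq> backlog h j \<and> demand I j (the (x j)) = best_value \<kappa> j (backlog h j)"
    using best_response[OF finite_backlog] by simp
qed (rule two_phase_one_sided[OF assms])

lemma static_started:
  assumes "one_sided_static I D \<pi>" "h \<in> set_pmf (run I \<pi> n)"
  shows "h = [] \<or> D \<subseteq> processed h"
  using assms(2)
proof (induction rule: reachable_induct)
  case (snoc h x ch)
  then show ?case using assms(1) by (auto simp: one_sided_static_def)
qed simp

lemma static_first_step:
  assumes "one_sided_static I D \<pi>" "h \<in> set_pmf (run I \<pi> (Suc n))"
  shows "D \<subseteq> processed h"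
proof -
  obtain h' where h': "h' \<in> set_pmf (run I \<pi> n)" "h \<in> set_pmf (policy_step I \<pi> h')"
    using assms(2) by auto
  have "h \<noteq> []"
  proof (cases "agents I \<subseteq> processed h'")
    case True
    then have "h' \<noteq> []" using nonempty by (auto simp: agents)
    then show ?thesis using True h'(2) by (simp add: policy_step_def)
  qed (use h'(2) in \<open>auto simp: policy_step_def\<close>)
  then show ?thesis using static_started[OF assms] by simp
qed

lemma static_one_sided:
  assumes "one_sided_static I D \<pi>" "possible I \<pi> h x" "\<not> D \<subseteq> processed h"
  shows "dom x \<subseteq> D"
  using assms static_started[of \<pi> h] by (auto simp: possible_def one_sided_static_def)

lemma adaptive_one_sided:
  assumes "one_sided_adaptive I D \<pi>" "possible I \<pi> h x" "\<not> D \<subseteq> processed h"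
  shows "dom x \<subseteq> D"
proof -
  obtain a where "a \<in> D" "dom x = {a}"
    using assms unfolding one_sided_adaptive_def by blast
  then show ?thesis by simp
qed

lemma static_first_action:
  assumes "one_sided_static I D \<pi>" "x \<in> set_pmf (\<pi> [])"
  shows "possible I \<pi> [] x" "dom x = D"
proof -
  have "[] \<in> set_pmf (run I \<pi> 0)" by simp
  moreover have "\<not> agents I \<subseteq> processed []" using nonempty by (auto simp: agents)
  ultimately show "possible I \<pi> [] x" using assms(2) unfolding possible_def by blast
  then show "dom x = D" using assms(1) by (simp add: one_sided_static_def)
qed

text \<open>
  After the first step of a static policy all of \<open>D\<close> is processed, and the backlogs are final.
\<close>

lemma static_backlog:
  fixes G :: "('a \<Rightarrow> 'a set) \<Rightarrow> real"
  assumes adm: "admissible I \<kappa> \<pi>" and static: "one_sided_static I D \<pi>"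
  shows "measure_pmf.expectation (run I \<pi> (Suc n)) (\<lambda>h. G (backlog h)) =
      measure_pmf.expectation (\<pi> []) (\<lambda>x. measure_pmf.expectation (choices I x)
         (\<lambda>ch. G (\<lambda>j. {i\<in>D. ch i = Some j})))"
proof (induction n)
  case 0
  have nf: "\<not> agents I \<subseteq> processed []" using nonempty by (auto simp: agents)
  let ?q = "\<lambda>x. map_pmf (\<lambda>ch. [(x, ch)]) (choices I x)"
  have run: "run I \<pi> (Suc 0) = bind_pmf (\<pi> []) ?q"
    using nf by (simp add: policy_step_def bind_return_pmf)
  have "finite (set_pmf (bind_pmf (\<pi> []) ?q))"
    using finite_run[OF adm, of "Suc 0"] unfolding run .
  from expectation_bind_pmf_finite[OF this]
  have "measure_pmf.expectation (run I \<pi> (Suc 0)) (\<lambda>h. G (backlog h)) =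
      measure_pmf.expectation (\<pi> []) (\<lambda>x. measure_pmf.expectation (choices I x)
         (\<lambda>ch. G (backlog [(x, ch)])))"
    unfolding run by simp
  also have "\<dots> = measure_pmf.expectation (\<pi> []) (\<lambda>x. measure_pmf.expectation (choices I x)
         (\<lambda>ch. G (\<lambda>j. {i\<in>D. ch i = Some j})))"
  proof (rule integral_cong_AE, simp, simp, rule AE_pmfI)
    fix x assume "x \<in> set_pmf (\<pi> [])"
    then have "dom x = D" by (rule static_first_action(2)[OF static])
    then have "backlog [(x, ch)] = (\<lambda>j. {i\<in>D. ch i = Some j})" for ch
      using chose_snoc[of "[]" x ch] by (intro ext) (auto simp: backlog_def)
    then show "measure_pmf.expectation (choices I x) (\<lambda>ch. G (backlog [(x, ch)])) =
        measure_pmf.expectation (choices I x) (\<lambda>ch. G (\<lambda>j. {i\<in>D. ch i = Some j}))"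
      by simp
  qed
  finally show ?case .
next
  case (Suc n)
  have same: "backlog (h @ [(x, ch)]) = backlog h"
    if "h \<in> set_pmf (run I \<pi> (Suc n))" "possible I \<pi> h x" for h x ch
    using static_first_step[OF static that(1)] possible_action(2)[OF adm that(2)]
    by (intro ext) (auto simp: backlog_def)
  have "measure_pmf.expectation (run I \<pi> (Suc (Suc n))) (\<lambda>h. G (backlog h)) \<le>
      measure_pmf.expectation (run I \<pi> (Suc n)) (\<lambda>h. G (backlog h))"
    by (rule expectation_run_step[OF adm]) (simp add: same del: run.simps)
  moreover have "measure_pmf.expectation (run I \<pi> (Suc (Suc n))) (\<lambda>h. - G (backlog h)) \<le>
      measure_pmf.expectation (run I \<pi> (Suc n)) (\<lambda>h. - G (backlog h))"
    by (rule expectation_run_step[OF adm]) (simp add: same del: run.simps)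
  ultimately have "measure_pmf.expectation (run I \<pi> (Suc (Suc n))) (\<lambda>h. G (backlog h)) =
      measure_pmf.expectation (run I \<pi> (Suc n)) (\<lambda>h. G (backlog h))"
    unfolding Bochner_Integration.integral_minus by linarith
  then show ?case using Suc by simp
qed

lemma card_agents_Suc: obtains m where "card (agents I) = Suc m"
proof -
  have "card (agents I) \<noteq> 0" using nonempty by (simp add: agents)
  then show ?thesis using that not0_implies_Suc by blast
qed

text \<open>
  Offer to each \<open>i\<close> independently a random assortment with distribution \<open>\<nu> i\<close>. The restriction to agents
  that are still to be processed has an effect only after the first step; it makes the policy
  \<open>initiating\<close>.
\<close>

definition offer :: "('a \<Rightarrow> 'a set pmf) \<Rightarrow> 'a policy" where
  "offer \<nu> h = map_pmf (\<lambda>x. x |` (- processed h)) (Pi_pmf D None (\<lambda>i. map_pmf Some (\<nu> i)))"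

lemma Pi_pmf_Some:
  assumes "x \<in> set_pmf (Pi_pmf D None (\<lambda>i. map_pmf Some (\<nu> i)))"
  shows "dom x = D" "i \<in> D \<Longrightarrow> the (x i) \<in> set_pmf (\<nu> i)"
proof -
  have x: "(i \<in> D \<longrightarrow> x i \<in> Some ` set_pmf (\<nu> i)) \<and> (i \<notin> D \<longrightarrow> x i = None)" for i
    using assms by (auto simp: set_Pi_pmf PiE_dflt_def)
  show "dom x = D"
  proof (rule set_eqI)
    show "i \<in> dom x \<longleftrightarrow> i \<in> D" for i using x[of i] by auto
  qed
  show "i \<in> D \<Longrightarrow> the (x i) \<in> set_pmf (\<nu> i)" using x[of i] by auto
qed

lemma offer_Nil: "offer \<nu> [] = Pi_pmf D None (\<lambda>i. map_pmf Some (\<nu> i))"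
proof -
  have "(\<lambda>x. x |` (- processed [])) = (\<lambda>x :: 'a action. x)"
    by (simp add: restrict_map_def fun_eq_iff)
  then show ?thesis unfolding offer_def by (simp only: map_pmf_ident)
qed

lemma offer_initiating:
  assumes "\<And>i B. i \<in> D \<Longrightarrow> B \<in> set_pmf (\<nu> i) \<Longrightarrow> B \<subseteq> R \<and> enat (card B) \<le> \<kappa> i"
  shows "initiating \<kappa> (offer \<nu>)"
  unfolding initiating_def
proof (intro allI impI ballI)
  fix h x assume h: "\<not> D \<subseteq> processed h" and "x \<in> set_pmf (offer \<nu> h)"
  then obtain y where y: "y \<in> set_pmf (Pi_pmf D None (\<lambda>i. map_pmf Some (\<nu> i)))"
    and x: "x = y |` (- processed h)"
    by (auto simp: offer_def)
  have "dom x = D - processed h" using Pi_pmf_Some(1)[OF y] by (auto simp: x)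
  moreover have "the (x i) \<subseteq> R \<and> enat (card (the (x i))) \<le> \<kappa> i" if "i \<in> D - processed h" for i
    using that Pi_pmf_Some(2)[OF y, of i] by (intro assms) (auto simp: x)
  ultimately show "dom x \<noteq> {} \<and> dom x \<subseteq> D - processed h \<and>
     (\<forall>i\<in>dom x. the (x i) \<subseteq> R \<and> enat (card (the (x i))) \<le> \<kappa> i)"
    using h by auto
qed

lemma offer_static: "one_sided_static I D (two_phase \<kappa> (offer \<nu>))"
  unfolding one_sided_static_def
proof (intro allI impI)
  fix x assume "possible I (two_phase \<kappa> (offer \<nu>)) [] x"
  then have "x \<in> set_pmf (offer \<nu> [])"
    using nonempty by (auto simp: possible_def two_phase_def)
  then show "dom x = D" unfolding offer_Nil by (rule Pi_pmf_Some(1))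
qed

text \<open>
  Assortments and choices are both independent across agents, so the backlog of \<open>j\<close> is an
  independent random set: the law of the choices is a product of mixtures.
\<close>

lemma offer_value:
  assumes init: "initiating \<kappa> (offer \<nu>)"
  shows "measure_pmf.expectation (run I (two_phase \<kappa> (offer \<nu>)) (card (agents I))) (\<lambda>h. g (backlog h j)) =
      multilinear D (\<lambda>i. pmf (bind_pmf (\<nu> i) (Choice I i)) (Some j)) g"
proof -
  let ?\<pi> = "two_phase \<kappa> (offer \<nu>)"
  let ?P = "Pi_pmf D None (\<lambda>i. map_pmf Some (\<nu> i))"
  let ?f = "\<lambda>ch :: 'a \<Rightarrow> 'a option. g {i\<in>D. ch i = Some j}"
  obtain m where m: "card (agents I) = Suc m" by (rule card_agents_Suc)
  have \<pi>: "?\<pi> [] = ?P"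
    using nonempty by (simp add: two_phase_def offer_Nil)
  have bounded: "\<bar>?f ch\<bar> \<le> (\<Sum>S\<in>Pow D. \<bar>g S\<bar>)" for ch
    by (intro member_le_sum[where f = "\<lambda>S. \<bar>g S\<bar>"]) auto
  have "measure_pmf.expectation (run I ?\<pi> (card (agents I))) (\<lambda>h. g (backlog h j)) =
      measure_pmf.expectation ?P (\<lambda>x. measure_pmf.expectation (choices I x) ?f)"
    unfolding m using static_backlog[OF two_phase_admissible[OF init] offer_static, where G = "\<lambda>b. g (b j)" and n = m]
    unfolding \<pi> .
  also have "\<dots> = measure_pmf.expectation (bind_pmf ?P (choices I)) ?f"
    by (rule expectation_bind_pmf[symmetric], rule bounded)
  also have "bind_pmf ?P (choices I) = bind_pmf ?P (\<lambda>x. Pi_pmf D None (\<lambda>i. Choice I i (the (x i))))"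
    using Pi_pmf_Some(1)[of _ \<nu>] by (intro bind_pmf_cong refl) (simp add: choices_def)
  also have "\<dots> = Pi_pmf D None (\<lambda>i. bind_pmf (map_pmf Some (\<nu> i)) (\<lambda>B. Choice I i (the B)))"
    by (rule Pi_pmf_bind[symmetric]) simp
  also have "\<dots> = Pi_pmf D None (\<lambda>i. bind_pmf (\<nu> i) (Choice I i))"
    by (simp add: bind_map_pmf)
  also have "measure_pmf.expectation \<dots> ?f =
      multilinear D (\<lambda>i. pmf (bind_pmf (\<nu> i) (Choice I i)) (Some j)) g"
    by (rule expectation_independent_set) simp
  finally show ?thesis .
qed

text \<open>
  Take for \<open>\<nu> i\<close> the distribution of the assortment that \<open>\<pi>\<close> shows to \<open>i\<close>. The backlog of each
  responding agent then keeps its marginals and becomes independent.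
\<close>

lemma static_policy_from_one_sided:
  assumes adm: "admissible I \<kappa> \<pi>"
    and one_sided: "\<And>h x. possible I \<pi> h x \<Longrightarrow> \<not> D \<subseteq> processed h \<Longrightarrow> dom x \<subseteq> D"
    and c: "c > 0"
    and gain: "\<And>j S T. j \<in> R \<Longrightarrow> S \<subseteq> D \<Longrightarrow> T \<subseteq> D \<Longrightarrow> best_value \<kappa> j T \<le>
      c * best_value \<kappa> j S + (\<Sum>i\<in>T. best_value \<kappa> j (insert i S) - best_value \<kappa> j S)"
  obtains \<pi>' where "admissible I \<kappa> \<pi>'" "one_sided_static I D \<pi>'"
    "(1 - exp (- c)) / c * expected_matches I \<pi> \<le> expected_matches I \<pi>'"
proof -
  let ?run = "run I \<pi> (card (agents I))"
  define \<nu> where "\<nu> i = map_pmf (\<lambda>h. shown h i) ?run" for i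
  let ?\<pi>' = "two_phase \<kappa> (offer \<nu>)"
  have init: "initiating \<kappa> (offer \<nu>)"
  proof (rule offer_initiating)
    fix i B assume i: "i \<in> D" and "B \<in> set_pmf (\<nu> i)"
    then obtain h where "h \<in> set_pmf ?run" "B = shown h i" by (auto simp: \<nu>_def)
    with shown_action[OF adm, of h _ i] i show "B \<subseteq> R \<and> enat (card B) \<le> \<kappa> i"
      by (auto simp: opposite_D)
  qed
  let ?c = "(1 - exp (- c)) / c"
  have "?c * expected_matches I \<pi> \<le> ?c * (\<Sum>j\<in>R. measure_pmf.expectation ?run (\<lambda>h. best_value \<kappa> j (backlog h j)))"
    using expected_matches_le_value[OF adm one_sided] c by (intro mult_left_mono) auto
  also have "\<dots> \<le> (\<Sum>j\<in>R. measure_pmf.expectation (run I ?\<pi>' (card (agents I)))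
             (\<lambda>h. best_value \<kappa> j (backlog h j)))"
    unfolding sum_distrib_left
  proof (rule sum_mono)
    fix j assume j: "j \<in> R"
    interpret monotone_submodular D "demand I j" using demand_monotone_submodular[OF j] .
    let ?\<mu> = "map_pmf (\<lambda>h. backlog h j) ?run"
    let ?g = "best_value \<kappa> j"
    have "?c * measure_pmf.expectation ?run (\<lambda>h. ?g (backlog h j)) = ?c * measure_pmf.expectation ?\<mu> ?g"
      by simp
    also have "\<dots> \<le> multilinear D (\<lambda>i. measure_pmf.prob ?\<mu> {T. i \<in> T}) ?g"
    proof (rule correlation_gap)
      show "set_pmf ?\<mu> \<subseteq> Pow D" using backlog_subset by auto
      show "?g S \<le> ?g T" if "S \<subseteq> T" "T \<subseteq> D" for S T
        using that fin by (intro capped_mono) auto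
      show "0 \<le> ?g {}" by (simp add: empty)
    qed (use c gain[OF j] in auto)
    also have "\<dots> = multilinear D (\<lambda>i. pmf (bind_pmf (\<nu> i) (Choice I i)) (Some j)) ?g"
    proof (rule multilinear_cong_prob)
      fix i assume i: "i \<in> D"
      have "measure_pmf.prob ?\<mu> {T. i \<in> T} = measure_pmf.prob ?run {h. chose h i j}"
        using i by (simp add: backlog_def vimage_def)
      also have "\<dots> = pmf (bind_pmf (\<nu> i) (Choice I i)) (Some j)"
        using expectation_chose[OF adm i] by (simp add: \<nu>_def bind_map_pmf pmf_bind)
      finally show "measure_pmf.prob ?\<mu> {T. i \<in> T} = pmf (bind_pmf (\<nu> i) (Choice I i)) (Some j)" .
    qed
    also have "\<dots> = measure_pmf.expectation (run I ?\<pi>' (card (agents I))) (\<lambda>h. ?g (backlog h j))"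
      using offer_value[OF init] by simp
    finally show "?c * measure_pmf.expectation ?run (\<lambda>h. ?g (backlog h j)) \<le> \<dots>" .
  qed
  also have "\<dots> \<le> expected_matches I ?\<pi>'"
    by (rule two_phase_value[OF init])
  finally show ?thesis
    using that two_phase_admissible[OF init] offer_static by blast
qed

text \<open>
  The order in which the initiating agents are processed is arbitrary; only the assortment shown next
  depends on the history.
\<close>

definition one_by_one :: "('a history \<Rightarrow> 'a set) \<Rightarrow> 'a policy" where
  "one_by_one A h = return_pmf [(SOME i. i \<in> D - processed h) \<mapsto> A h]"

lemma one_by_one_next:
  assumes "\<not> D \<subseteq> processed h"
  shows "(SOME i. i \<in> D - processed h) \<in> D - processed h"
  using assms by (intro someI_ex[of "\<lambda>i. i \<in> D - processed h"]) auto

lemma one_by_one_initiating: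
  assumes "\<And>h. A h \<subseteq> R" "\<And>h i. i \<in> D \<Longrightarrow> enat (card (A h)) \<le> \<kappa> i"
  shows "initiating \<kappa> (one_by_one A)"
  using one_by_one_next assms by (auto simp: initiating_def one_by_one_def)

lemma one_by_one_adaptive: "one_sided_adaptive I D (two_phase \<kappa> (one_by_one A))"
  unfolding one_sided_adaptive_def
proof (intro allI impI)
  fix h x assume p: "possible I (two_phase \<kappa> (one_by_one A)) h x \<and> \<not> D \<subseteq> processed h"
  then have "x \<in> set_pmf (two_phase \<kappa> (one_by_one A) h)" by (simp add: possible_def)
  with p have "x = [(SOME i. i \<in> D - processed h) \<mapsto> A h]" "\<not> D \<subseteq> processed h"
    by (simp_all add: two_phase_def one_by_one_def)
  then show "\<exists>a\<in>D. dom x = {a}" using one_by_one_next[of h] by auto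
qed

end

lemma two_sidesI:
  assumes "valid_market I" "regular I" "D \<in> {Customers I, Suppliers I}"
  obtains R where "two_sides I D R"
proof -
  have "two_sides I D (if D = Customers I then Suppliers I else Customers I)"
    using assms by unfold_locales auto
  then show ?thesis using that by blast
qed

lemma OPT_OS_upper:
  assumes "valid_market I" "D \<in> {Customers I, Suppliers I}"
    "admissible I (cap w I D) \<pi>" "one_sided_static I D \<pi>"
  shows "expected_matches I \<pi> \<le> OPT_OS w I"
  unfolding OPT_OS_def
proof (rule cSup_upper)
  show "bdd_above {expected_matches I \<pi> | \<pi> D. D \<in> {Customers I, Suppliers I} \<and>
            admissible I (cap w I D) \<pi> \<and> one_sided_static I D \<pi>}"
    using assms(1) expected_matches_le[of I] by (intro bdd_aboveI) (auto simp: valid_market_def)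
qed (use assms in blast)

lemma OPT_OA_upper:
  assumes "valid_market I" "D \<in> {Customers I, Suppliers I}"
    "admissible I (cap w I D) \<pi>" "one_sided_adaptive I D \<pi>"
  shows "expected_matches I \<pi> \<le> OPT_OA w I"
  unfolding OPT_OA_def
proof (rule cSup_upper)
  show "bdd_above {expected_matches I \<pi> | \<pi> D. D \<in> {Customers I, Suppliers I} \<and>
            admissible I (cap w I D) \<pi> \<and> one_sided_adaptive I D \<pi>}"
    using assms(1) expected_matches_le[of I] by (intro bdd_aboveI) (auto simp: valid_market_def)
qed (use assms in blast)

lemma OPT_OS_least:
  assumes "valid_market I" "regular I"
    and bound: "\<And>D \<pi>. D \<in> {Customers I, Suppliers I} \<Longrightarrow> admissible I (cap w I D) \<pi> \<Longrightarrow>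
      one_sided_static I D \<pi> \<Longrightarrow> expected_matches I \<pi> \<le> v"
  shows "OPT_OS w I \<le> v"
  unfolding OPT_OS_def
proof (rule cSup_least)
  obtain R where "two_sides I (Customers I) R"
    using two_sidesI[OF assms(1,2)] by blast
  then interpret two_sides I "Customers I" R .
  have "initiating (cap w I (Customers I)) (offer (\<lambda>_. return_pmf {}))"
    by (intro offer_initiating) (auto simp: zero_enat_def[symmetric])
  \<comment> \<open>Showing the empty assortment to everybody is admissible, so the supremum is over a nonempty set.\<close>
  from two_phase_admissible[OF this] offer_static
  show "{expected_matches I \<pi> | \<pi> D. D \<in> {Customers I, Suppliers I} \<and>
            admissible I (cap w I D) \<pi> \<and> one_sided_static I D \<pi>} \<noteq> {}"
    by blast
qed (use bound in blast)

lemma OPT_OA_least: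
  assumes "valid_market I" "regular I"
    and bound: "\<And>D \<pi>. D \<in> {Customers I, Suppliers I} \<Longrightarrow> admissible I (cap w I D) \<pi> \<Longrightarrow>
      one_sided_adaptive I D \<pi> \<Longrightarrow> expected_matches I \<pi> \<le> v"
  shows "OPT_OA w I \<le> v"
  unfolding OPT_OA_def
proof (rule cSup_least)
  obtain R where "two_sides I (Customers I) R"
    using two_sidesI[OF assms(1,2)] by blast
  then interpret two_sides I "Customers I" R .
  have "initiating (cap w I (Customers I)) (one_by_one (\<lambda>_. {}))"
    by (intro one_by_one_initiating) (auto simp: zero_enat_def[symmetric])
  from two_phase_admissible[OF this] one_by_one_adaptive
  show "{expected_matches I \<pi> | \<pi> D. D \<in> {Customers I, Suppliers I} \<and>
            admissible I (cap w I D) \<pi> \<and> one_sided_adaptive I D \<pi>} \<noteq> {}"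
    by blast
qed (use bound in blast)

lemma OPT_OA_le_OPT_OS:
  assumes valid: "valid_market I" and regular: "regular I" and c: "c > 0"
    and gain: "\<And>D R j S T. two_sides I D R \<Longrightarrow> j \<in> R \<Longrightarrow> S \<subseteq> D \<Longrightarrow> T \<subseteq> D \<Longrightarrow>
      capped (demand I j) (cap w I D j) T \<le> c * capped (demand I j) (cap w I D j) S +
        (\<Sum>i\<in>T. capped (demand I j) (cap w I D j) (insert i S) - capped (demand I j) (cap w I D j) S)"
  shows "OPT_OA w I \<le> c / (1 - exp (- c)) * OPT_OS w I"
proof (rule OPT_OA_least[OF valid regular])
  fix D \<pi> assume D: "D \<in> {Customers I, Suppliers I}" and adm: "admissible I (cap w I D) \<pi>"
    and adaptive: "one_sided_adaptive I D \<pi>"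
  obtain R where ts: "two_sides I D R" using two_sidesI[OF valid regular D] .
  interpret two_sides I D R by (fact ts)
  obtain \<pi>' where \<pi>': "admissible I (cap w I D) \<pi>'" "one_sided_static I D \<pi>'"
    "(1 - exp (- c)) / c * expected_matches I \<pi> \<le> expected_matches I \<pi>'"
  proof (rule static_policy_from_one_sided[OF adm _ c])
    show "dom x \<subseteq> D" if "possible I \<pi> h x" "\<not> D \<subseteq> processed h" for h x
      by (rule adaptive_one_sided[OF adaptive that])
  qed (use gain[OF ts] in blast)+
  have pos: "1 - exp (- c) > 0" using c by simp
  have "(1 - exp (- c)) / c * expected_matches I \<pi> \<le> OPT_OS w I"
    using \<pi>'(3) OPT_OS_upper[OF valid D \<pi>'(1,2)] by linarith
  then have "c / (1 - exp (- c)) * ((1 - exp (- c)) / c * expected_matches I \<pi>)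
      \<le> c / (1 - exp (- c)) * OPT_OS w I"
    using c pos by (intro mult_left_mono) auto
  then show "expected_matches I \<pi> \<le> c / (1 - exp (- c)) * OPT_OS w I"
    using c pos by simp
qed

lemma one_sided_ratio: "1 / (1 - exp (- 1)) = exp 1 / (exp 1 - 1 :: real)"
  by (simp add: exp_minus divide_simps)

text \<open>
  With \<open>e = exp 1\<close> the left-hand side is \<open>2 * e\<^sup>2 / ((e - 1) * (e + 1))\<close>, so that the claim is
  \<open>2 * (e - 1) \<le> e + 1\<close>, that is, \<open>e \<le> 3\<close>.
\<close>

lemma two_way_ratio: "2 / (1 - exp (- 2)) \<le> (exp 1 / (exp 1 - 1 :: real))\<^sup>2"
proof -
  define e :: real where "e = exp 1"
  have e: "1 < e" "e \<le> 3" unfolding e_def using exp_le by auto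
  have "exp (- 2 :: real) = 1 / e\<^sup>2"
    by (simp add: e_def exp_minus power2_eq_square inverse_eq_divide flip: exp_add)
  moreover have "e\<^sup>2 > 1" using e by (simp add: one_less_power)
  ultimately have "2 / (1 - exp (- 2 :: real)) = 2 * e\<^sup>2 / ((e - 1) * (e + 1))"
    using e by (simp add: divide_simps power2_eq_square algebra_simps)
  also have "\<dots> \<le> e\<^sup>2 / ((e - 1) * (e - 1))"
  proof -
    have "2 * (e - 1) \<le> e + 1" using e by simp
    then have "2 * e\<^sup>2 * ((e - 1) * (e - 1)) \<le> e\<^sup>2 * ((e - 1) * (e + 1))"
      using e mult_left_mono[of "2 * (e - 1)" "e + 1" "e\<^sup>2 * (e - 1)"] by (simp add: mult_ac)
    then show ?thesis using e by (simp add: divide_simps mult_ac)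
  qed
  finally show ?thesis by (simp add: e_def power_divide power2_eq_square)
qed

lemma OPT_OA_le_two_way:
  assumes "valid_market I" "regular I"
  shows "OPT_OA Two_Way I \<le> 2 / (1 - exp (- 2)) * OPT_OS Two_Way I"
proof (rule OPT_OA_le_OPT_OS[OF assms])
  fix D R j S T
  assume ts: "two_sides I D R" and j: "j \<in> R" and ST: "S \<subseteq> D" "T \<subseteq> D"
  interpret two_sides I D R by (fact ts)
  interpret monotone_submodular D "demand I j" using demand_monotone_submodular[OF j] .
  have "Budget I j > 0" using valid j by (auto simp: valid_market_def agents)
  then show "capped (demand I j) (cap Two_Way I D j) T \<le> 2 * capped (demand I j) (cap Two_Way I D j) S +
        (\<Sum>i\<in>T. capped (demand I j) (cap Two_Way I D j) (insert i S) - capped (demand I j) (cap Two_Way I D j) S)"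
    using ST by (intro capped_gain) (simp_all add: zero_enat_def)
qed simp

lemma OPT_OA_le_one_way:
  assumes "valid_market I" "regular I"
  shows "OPT_OA One_Way I \<le> exp 1 / (exp 1 - 1) * OPT_OS One_Way I"
  unfolding one_sided_ratio[symmetric]
proof (rule OPT_OA_le_OPT_OS[OF assms])
  fix D R j S T
  assume ts: "two_sides I D R" and j: "j \<in> R" and ST: "S \<subseteq> D" "T \<subseteq> D"
  interpret two_sides I D R by (fact ts)
  interpret monotone_submodular D "demand I j" using demand_monotone_submodular[OF j] .
  have "cap One_Way I D j = \<infinity>" using j disjoint by auto
  then show "capped (demand I j) (cap One_Way I D j) T \<le> 1 * capped (demand I j) (cap One_Way I D j) S +
        (\<Sum>i\<in>T. capped (demand I j) (cap One_Way I D j) (insert i S) - capped (demand I j) (cap One_Way I D j) S)"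
    using capped_gain_infinity[OF ST] by simp
qed simp

lemma mnlE:
  assumes "mnl I" "a \<in> agents I"
  obtains u where "\<And>b. b \<in> opposite I a \<Longrightarrow> u b \<ge> 0"
    "\<And>B b. B \<subseteq> opposite I a \<Longrightarrow> b \<in> B \<Longrightarrow> choice_prob I a b B = u b / (1 + sum u B)"
  using bspec[OF assms(1)[unfolded mnl_def] assms(2)]
  by (elim exE conjE) (rule that, auto)

lemma mnl_regular:
  assumes valid: "valid_market I" and mnl: "mnl I"
  shows "regular I"
  unfolding regular_def
proof (intro ballI allI impI)
  fix a B B' b
  assume a: "a \<in> agents I" and B: "B \<subseteq> B' \<and> B' \<subseteq> opposite I a" and b: "b \<in> B"
  obtain u where u: "\<And>b. b \<in> opposite I a \<Longrightarrow> u b \<ge> 0"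
    and ch: "\<And>B b. B \<subseteq> opposite I a \<Longrightarrow> b \<in> B \<Longrightarrow> choice_prob I a b B = u b / (1 + sum u B)"
    by (rule mnlE[OF mnl a]) (rule that)
  have "finite (opposite I a)" using valid by (auto simp: valid_market_def opposite_def)
  then have "finite B'" using B finite_subset by blast
  then have "sum u B \<le> sum u B'" using B u by (intro sum_mono2) auto
  moreover have "0 \<le> sum u B" using B u by (intro sum_nonneg) auto
  moreover have "0 \<le> u b" using B b u by auto
  ultimately have "u b / (1 + sum u B') \<le> u b / (1 + sum u B)"
    by (intro divide_left_mono) auto
  then show "choice_prob I a b B' \<le> choice_prob I a b B"
    using ch[of B' b] ch[of B b] B b by (simp add: subset_iff)
qed

lemma OPT_OA_le_mnl:
  assumes valid: "valid_market I" and mnl: "mnl I"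
  shows "OPT_OA Two_Way I \<le> exp 1 / (exp 1 - 1) * OPT_OS Two_Way I"
  unfolding one_sided_ratio[symmetric]
proof (rule OPT_OA_le_OPT_OS[OF valid mnl_regular[OF assms]])
  fix D R j S T
  assume ts: "two_sides I D R" and j: "j \<in> R" and ST: "S \<subseteq> D" "T \<subseteq> D"
  interpret two_sides I D R by (fact ts)
  interpret monotone_submodular D "demand I j" using demand_monotone_submodular[OF j] .
  obtain u where u: "\<And>b. b \<in> D \<Longrightarrow> u b \<ge> 0"
    and ch: "\<And>B b. B \<subseteq> D \<Longrightarrow> b \<in> B \<Longrightarrow> choice_prob I j b B = u b / (1 + sum u B)"
  proof (rule mnlE[OF mnl])
    show "j \<in> agents I" using j by (simp add: agents)
  qed (unfold opposite_R[OF j], rule that)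
  have "demand I j B = sum u B / (1 + sum u B)" if "B \<subseteq> D" for B
    using ch[OF that] by (simp add: demand_def sum_divide_distrib)
  from capped_gain_mnl[OF u this ST]
  show "capped (demand I j) (cap Two_Way I D j) T \<le> 1 * capped (demand I j) (cap Two_Way I D j) S +
        (\<Sum>i\<in>T. capped (demand I j) (cap Two_Way I D j) (insert i S) - capped (demand I j) (cap Two_Way I D j) S)"
    by simp
qed simp

lemma adaptivity_gap_le:
  assumes "\<And>I. I \<in> \<I> \<Longrightarrow> OPT_OA w I \<le> r * OPT_OS w I"
  shows "adaptivity_gap w \<I> \<le> ereal r"
  unfolding adaptivity_gap_def using assms by (intro SUP_least) (auto simp: divide_le_eq)

section \<open>A market in which static offers collide\<close>

text \<open>
  Choose somebody with probability \<open>q\<close> if anybody is offered, and then uniformly. The demand is \<open>q\<close> on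
  every nonempty set, so it does not reward large assortments.
\<close>

definition uniform_pick :: "real \<Rightarrow> 'a set \<Rightarrow> 'a option pmf" where
  "uniform_pick q B =
     (if finite B \<and> B \<noteq> {}
      then bind_pmf (bernoulli_pmf q) (\<lambda>b. if b then map_pmf Some (pmf_of_set B) else return_pmf None)
      else return_pmf None)"

lemma pmf_uniform_pick:
  assumes "0 \<le> q" "q \<le> 1" "finite B"
  shows "pmf (uniform_pick q B) (Some b) = (if b \<in> B then q / card B else 0)"
proof (cases "B = {}")
  case False
  have "pmf (map_pmf Some (pmf_of_set B)) (Some b) = pmf (pmf_of_set B) b"
    by (rule pmf_map_inj') simp
  then show ?thesis
    using assms False by (simp add: uniform_pick_def pmf_bind pmf_of_set)
qed (simp add: uniform_pick_def)

lemma set_pmf_uniform_pick: "set_pmf (uniform_pick q B) \<subseteq> insert None (Some ` B)"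
proof (cases "finite B \<and> B \<noteq> {}")
  case True
  then have "set_pmf (pmf_of_set B) = B" by simp
  then show ?thesis by (auto simp: uniform_pick_def split: if_splits)
qed (auto simp: uniform_pick_def)

lemma multilinear_nonempty:
  assumes "finite N"
  shows "multilinear N p (\<lambda>S. of_bool (S \<noteq> {})) = 1 - (\<Prod>i\<in>N. 1 - p i)"
  using assms
proof (induction N rule: finite_induct)
  case (insert x N)
  show ?case
    unfolding multilinear_insert[OF insert.hyps] insert.IH
    using insert.hyps by (simp add: multilinear_const algebra_simps)
qed simp

lemma power_ge_tangent:
  fixes r :: real
  assumes "0 < r"
  shows "r ^ n * (1 + (real k - real n) * ln r) \<le> r ^ k"
proof -
  have "r ^ k = exp (real k * ln r)" using assms by (simp add: exp_of_nat_mult)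
  also have "\<dots> = r ^ n * exp ((real k - real n) * ln r)"
    using assms by (simp add: exp_of_nat_mult left_diff_distrib exp_diff)
  finally show ?thesis using assms by (simp add: mult_left_mono)
qed

text \<open>
  Distributing at most \<open>card S * n\<close> trials over \<open>S\<close>, each failing with probability \<open>r\<close>, the expected
  number of members of \<open>S\<close> with a success is largest for an even distribution: the function is
  concave in the number of trials and lies below its tangent at \<open>n\<close>.
\<close>

lemma sum_one_minus_power_le:
  fixes r :: real
  assumes r: "0 < r" "r \<le> 1" and k: "(\<Sum>j\<in>S. k j) \<le> card S * n"
  shows "(\<Sum>j\<in>S. 1 - r ^ k j) \<le> card S * (1 - r ^ n)"
proof -
  have "(\<Sum>j\<in>S. 1 - r ^ k j) \<le> (\<Sum>j\<in>S. 1 - r ^ n * (1 + (real (k j) - real n) * ln r))"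
    using power_ge_tangent[OF r(1)] by (intro sum_mono) auto
  also have "\<dots> = card S * (1 - r ^ n) - r ^ n * ln r * (real (\<Sum>j\<in>S. k j) - card S * n)"
    by (simp add: sum_subtractf sum.distrib sum_distrib_left sum_distrib_right algebra_simps)
  also have "\<dots> \<le> card S * (1 - r ^ n)"
  proof -
    have "real (\<Sum>j\<in>S. k j) \<le> real (card S * n)" using k by (rule of_nat_mono)
    moreover have "ln r \<le> 0" using r by simp
    ultimately have "0 \<le> (r ^ n * ln r) * (real (\<Sum>j\<in>S. k j) - card S * n)"
      using r by (intro mult_nonpos_nonpos) (auto simp: mult_le_0_iff)
    then show ?thesis by simp
  qed
  finally show ?thesis .
qed

text \<open>
  The number \<open>n\<close> of suppliers is a square only in order that the standard deviation of the number of
  acceptances, about \<open>sqrt n\<close>, can be bounded by an integer \<open>m\<close>.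
\<close>

locale gap_instance =
  fixes C S :: "'a set" and m n :: nat
  assumes m: "m \<ge> 2" and fin: "finite C" "finite S" and disj: "C \<inter> S = {}"
    and n_eq: "n = m\<^sup>2" and card_S: "card S = n" and card_C: "card C = n\<^sup>2"
begin

definition q :: "'a \<Rightarrow> real" where "q a = (if a \<in> C then 1 / n else 1)"

definition I :: "'a market" where
  "I = \<lparr>Customers = C, Suppliers = S, Budget = \<lambda>_. 1, Choice = \<lambda>a. uniform_pick (q a)\<rparr>"

lemma I_simps [simp]: "Customers I = C" "Suppliers I = S" "Budget I a = 1"
    "Choice I a = uniform_pick (q a)"
  by (simp_all add: I_def)

lemma n_ge: "n \<ge> 2"
  using m power_mono[of 2 m 2] by (simp add: n_eq)

lemma q: "0 < q a" "q a \<le> 1" "0 \<le> q a"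
  using n_ge by (auto simp: q_def)

lemma finite_offer: "B \<subseteq> opposite I a \<Longrightarrow> finite B"
  using fin by (auto simp: opposite_def intro: finite_subset split: if_splits)

lemma choice_prob_I: "finite B \<Longrightarrow> choice_prob I a b B = (if b \<in> B then q a / card B else 0)"
  using q by (simp add: choice_prob_def pmf_uniform_pick)

lemma demand_I: "finite B \<Longrightarrow> demand I a B = q a * of_bool (B \<noteq> {})"
  by (simp add: demand_def choice_prob_I)

lemma valid: "valid_market I"
proof -
  have ne: "C \<noteq> {}" "S \<noteq> {}" using card_C card_S n_ge by auto
  have "mono_on (Pow (opposite I a)) (demand I a)" for a
    using q by (auto simp: mono_on_def demand_I finite_offer intro!: mult_left_mono)
  moreover have "submodular_on (opposite I a) (demand I a)" for a
    unfolding submodular_on_def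
  proof (intro allI impI)
    fix X Y assume XY: "X \<subseteq> opposite I a" "Y \<subseteq> opposite I a"
    have "finite X" "finite Y" using XY finite_offer by auto
    then show "demand I a (X \<union> Y) + demand I a (X \<inter> Y) \<le> demand I a X + demand I a Y"
      using q by (auto simp: demand_I)
  qed
  moreover have "set_pmf (Choice I a B) \<subseteq> insert None (Some ` B)" for a B
    unfolding I_simps by (rule set_pmf_uniform_pick)
  ultimately show ?thesis
    using ne fin disj unfolding valid_market_def by simp
qed

lemma regular: "regular I"
  unfolding regular_def
proof (intro ballI allI impI)
  fix a B B' b assume B: "B \<subseteq> B' \<and> B' \<subseteq> opposite I a" and b: "b \<in> B"
  have f: "finite B'" using B finite_offer by auto
  then have f': "finite B" using B finite_subset by blast
  have "card B \<le> card B'" "card B > 0" using B b f f' by (auto simp: card_mono card_gt_0_iff)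
  then have "q a / card B' \<le> q a / card B" using q by (intro divide_left_mono) auto
  then show "choice_prob I a b B' \<le> choice_prob I a b B" using B b f f' by (auto simp: choice_prob_I)
qed

lemma cap_I: "1 \<le> cap w I D a" "a \<in> D \<Longrightarrow> cap w I D a = 1"
  by (cases w; simp add: one_enat_def)+

lemma capped_demand_I:
  assumes "finite B" "1 \<le> k"
  shows "capped (demand I a) k B = q a * of_bool (B \<noteq> {})"
proof (rule antisym)
  show "capped (demand I a) k B \<le> q a * of_bool (B \<noteq> {})"
    unfolding capped_le_iff[OF assms(1)] using q assms(1) by (auto simp: demand_I finite_subset)
  show "q a * of_bool (B \<noteq> {}) \<le> capped (demand I a) k B"
  proof (cases "B = {}")
    case False
    then obtain b where "b \<in> B" by auto
    then have "demand I a {b} \<le> capped (demand I a) k B"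
      using assms by (intro capped_upper) (auto simp: one_enat_def)
    then show ?thesis using False by (simp add: demand_I)
  qed (simp add: demand_I)
qed

text \<open>
  There are only \<open>n\<close> suppliers, each chooses at most one customer, and a customer responds positively
  with probability at most \<open>1 / n\<close>.
\<close>

lemma static_from_suppliers_le:
  assumes adm: "admissible I (cap w I S) \<pi>" and static: "one_sided_static I S \<pi>"
  shows "expected_matches I \<pi> \<le> 1"
proof -
  interpret two_sides I S C using valid regular by unfold_locales auto
  let ?E = "measure_pmf.expectation (run I \<pi> (card (agents I)))"
  let ?\<kappa> = "cap w I S"
  have "expected_matches I \<pi> \<le> (\<Sum>j\<in>C. ?E (\<lambda>h. best_value ?\<kappa> j (backlog h j)))"
    using expected_matches_le_value[OF adm static_one_sided[OF static]] .
  also have "\<dots> \<le> (\<Sum>j\<in>C. \<Sum>i\<in>S. 1 / n * ?E (\<lambda>h. pmf (Choice I i (shown h i)) (Some j)))"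
  proof (rule sum_mono)
    fix j assume j: "j \<in> C"
    have "?E (\<lambda>h. best_value ?\<kappa> j (backlog h j)) \<le> ?E (\<lambda>h. \<Sum>i\<in>S. 1 / n * indicator {h. chose h i j} h)"
    proof (intro integral_mono_AE integrable_run[OF adm] AE_pmfI)
      fix h
      have "best_value ?\<kappa> j (backlog h j) = 1 / n * of_bool (backlog h j \<noteq> {})"
        using j cap_I(1) by (simp add: capped_demand_I q_def)
      also have "\<dots> \<le> 1 / n * card (backlog h j)"
        by (intro mult_left_mono) (auto simp: Suc_le_eq card_gt_0_iff)
      also have "real (card (backlog h j)) = (\<Sum>i\<in>S. indicator {h. chose h i j} h)"
        using fin by (simp add: backlog_def indicator_def Int_def)
      finally show "best_value ?\<kappa> j (backlog h j) \<le> (\<Sum>i\<in>S. 1 / n * indicator {h. chose h i j} h)"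
        by (simp only: sum_distrib_left)
    qed
    also have "\<dots> = (\<Sum>i\<in>S. 1 / n * measure_pmf.prob (run I \<pi> (card (agents I))) {h. chose h i j})"
      by (subst Bochner_Integration.integral_sum) (auto intro!: integrable_run[OF adm])
    also have "\<dots> = (\<Sum>i\<in>S. 1 / n * ?E (\<lambda>h. pmf (Choice I i (shown h i)) (Some j)))"
      by (intro sum.cong refl) (simp only: expectation_chose[OF adm])
    finally show "?E (\<lambda>h. best_value ?\<kappa> j (backlog h j)) \<le> \<dots>" .
  qed
  also have "\<dots> = (\<Sum>i\<in>S. 1 / n * ?E (\<lambda>h. \<Sum>j\<in>C. pmf (Choice I i (shown h i)) (Some j)))"
    by (subst sum.swap, subst Bochner_Integration.integral_sum)
       (auto intro!: integrable_run[OF adm] simp: sum_distrib_left)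
  also have "\<dots> \<le> (\<Sum>i\<in>S. 1 / n * 1)"
    using sum_pmf_Some_le_1[OF fin(1)]
    by (intro sum_mono mult_left_mono measure_pmf.integral_le_const integrable_run[OF adm] AE_pmfI) auto
  also have "\<dots> = 1" using card_S n_ge by simp
  finally show ?thesis .
qed

text \<open>
  Each customer is offered at most one supplier. A supplier offered to \<open>k\<close> customers matches unless all
  of them decline, with probability \<open>1 - (1 - 1 / n) ^ k\<close>, and the numbers \<open>k\<close> add up to at most \<open>n\<^sup>2\<close>.
\<close>

lemma static_from_customers_le:
  assumes adm: "admissible I (cap w I C) \<pi>" and static: "one_sided_static I C \<pi>"
  shows "expected_matches I \<pi> \<le> n * (1 - (1 - 1 / n) ^ n)"
proof -
  interpret two_sides I C S using valid regular by unfold_locales auto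
  let ?E = "measure_pmf.expectation (run I \<pi> (card (agents I)))"
  let ?\<kappa> = "cap w I C"
  let ?r = "1 - 1 / n :: real"
  obtain k where k: "card (agents I) = Suc k" by (rule card_agents_Suc)
  have "[] \<in> set_pmf (run I \<pi> 0)" "\<not> agents I \<subseteq> processed []"
    using nonempty by (simp_all add: agents)
  then have fin\<pi>: "finite (set_pmf (\<pi> []))" by (rule finite_policy[OF adm])
  have "expected_matches I \<pi> \<le> (\<Sum>j\<in>S. ?E (\<lambda>h. best_value ?\<kappa> j (backlog h j)))"
    using expected_matches_le_value[OF adm static_one_sided[OF static]] .
  also have "\<dots> = (\<Sum>j\<in>S. ?E (\<lambda>h. of_bool (backlog h j \<noteq> {})))"
  proof (intro sum.cong refl)
    fix j assume "j \<in> S"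
    then have "best_value ?\<kappa> j (backlog h j) = of_bool (backlog h j \<noteq> {})" for h
      using cap_I(1) disj by (simp add: capped_demand_I) (auto simp: q_def)
    then show "?E (\<lambda>h. best_value ?\<kappa> j (backlog h j)) = ?E (\<lambda>h. of_bool (backlog h j \<noteq> {}))"
      by simp
  qed
  also have "\<dots> = (\<Sum>j\<in>S. measure_pmf.expectation (\<pi> []) (\<lambda>x. measure_pmf.expectation (choices I x)
         (\<lambda>ch. of_bool ({i\<in>C. ch i = Some j} \<noteq> {}))))"
    unfolding k
    by (intro sum.cong refl) (rule static_backlog[OF adm static, where n = k and G = "\<lambda>b. of_bool (b _ \<noteq> {})"])
  also have "\<dots> = measure_pmf.expectation (\<pi> []) (\<lambda>x. \<Sum>j\<in>S. measure_pmf.expectation (choices I x)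
         (\<lambda>ch. of_bool ({i\<in>C. ch i = Some j} \<noteq> {})))"
    by (intro Bochner_Integration.integral_sum[symmetric] integrable_measure_pmf_finite fin\<pi>)
  also have "\<dots> \<le> n * (1 - ?r ^ n)"
  proof (intro measure_pmf.integral_le_const integrable_measure_pmf_finite fin\<pi> AE_pmfI)
    fix x assume "x \<in> set_pmf (\<pi> [])"
    note x = static_first_action[OF static this]
    note act = possible_action[OF adm x(1)]
    let ?k = "\<lambda>j. card {i\<in>C. j \<in> the (x i)}"
    have B: "the (x i) \<subseteq> S" "card (the (x i)) \<le> 1" if "i \<in> C" for i
      using act(3,4)[of i] that x(2) cap_I(2)[of i C w] opposite_D[OF that] by (auto simp: one_enat_def)
    have pick: "pmf (Choice I i (the (x i))) (Some j) = (if j \<in> the (x i) then 1 / n else 0)"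
      if "i \<in> C" for i j
    proof -
      have f: "finite (the (x i))" using B(1)[OF that] fin finite_subset by blast
      have "card (the (x i)) = 1" if "j \<in> the (x i)"
      proof -
        have "card (the (x i)) > 0" using f that by (auto simp: card_gt_0_iff)
        with B(2)[OF \<open>i \<in> C\<close>] show ?thesis by simp
      qed
      then show ?thesis using f that q by (simp add: pmf_uniform_pick) (auto simp: q_def)
    qed
    have "(\<Sum>j\<in>S. measure_pmf.expectation (choices I x) (\<lambda>ch. of_bool ({i\<in>C. ch i = Some j} \<noteq> {})))
        = (\<Sum>j\<in>S. 1 - ?r ^ ?k j)"
    proof (rule sum.cong[OF refl])
      fix j
      have "measure_pmf.expectation (choices I x) (\<lambda>ch. of_bool ({i\<in>C. ch i = Some j} \<noteq> {})) =
          multilinear C (\<lambda>i. pmf (Choice I i (the (x i))) (Some j)) (\<lambda>S. of_bool (S \<noteq> {}))"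
        unfolding choices_def x(2) using fin(1) by (rule expectation_independent_set)
      also have "\<dots> = 1 - (\<Prod>i\<in>C. 1 - pmf (Choice I i (the (x i))) (Some j))"
        by (rule multilinear_nonempty[OF fin(1)])
      also have "(\<Prod>i\<in>C. 1 - pmf (Choice I i (the (x i))) (Some j)) = (\<Prod>i\<in>C. if j \<in> the (x i) then ?r else 1)"
        by (intro prod.cong refl) (simp only: pick, simp)
      also have "\<dots> = ?r ^ ?k j"
        using fin(1) by (simp add: prod.If_cases Int_def)
      finally show "measure_pmf.expectation (choices I x) (\<lambda>ch. of_bool ({i\<in>C. ch i = Some j} \<noteq> {})) = 1 - ?r ^ ?k j" .
    qed
    also have "\<dots> \<le> card S * (1 - ?r ^ n)"
    proof (rule sum_one_minus_power_le)
      show "0 < ?r" "?r \<le> 1" using n_ge by auto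
      have "(\<Sum>j\<in>S. ?k j) = (\<Sum>j\<in>S. \<Sum>i\<in>C. of_bool (j \<in> the (x i)))"
        using fin(1) by (simp add: Int_def)
      also have "\<dots> = (\<Sum>i\<in>C. \<Sum>j\<in>S. of_bool (j \<in> the (x i)))" by (rule sum.swap)
      also have "\<dots> = (\<Sum>i\<in>C. card (S \<inter> the (x i)))"
        using fin(2) by simp
      also have "\<dots> \<le> (\<Sum>i\<in>C. 1)"
        using B by (intro sum_mono) (simp add: Int_absorb1)
      finally show "(\<Sum>j\<in>S. ?k j) \<le> card S * n"
        using card_C card_S by (simp add: power2_eq_square)
    qed
    finally show "(\<Sum>j\<in>S. measure_pmf.expectation (choices I x) (\<lambda>ch. of_bool ({i\<in>C. ch i = Some j} \<noteq> {})))
        \<le> n * (1 - ?r ^ n)"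
      by (simp add: card_S)
  qed
  finally show ?thesis .
qed

lemma OPT_OS_le: "OPT_OS w I \<le> n * (1 - (1 - 1 / n) ^ n)"
proof (rule OPT_OS_least[OF valid regular])
  fix D \<pi> assume D: "D \<in> {Customers I, Suppliers I}" and adm: "admissible I (cap w I D) \<pi>"
    and static: "one_sided_static I D \<pi>"
  show "expected_matches I \<pi> \<le> n * (1 - (1 - 1 / n) ^ n)"
  proof (cases "D = C")
    case True
    then show ?thesis using static_from_customers_le adm static by simp
  next
    case False
    then have "expected_matches I \<pi> \<le> 1" using D static_from_suppliers_le adm static by auto
    also have "1 \<le> n * (1 - (1 - 1 / n :: real) ^ n)"
    proof -
      have "(1 - 1 / n :: real) ^ n \<le> (1 - 1 / n) ^ 1"
        using n_ge by (intro power_decreasing) auto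
      then have "n * (1 / n) \<le> n * (1 - (1 - 1 / n :: real) ^ n)"
        by (intro mult_left_mono) auto
      then show ?thesis using n_ge by simp
    qed
    finally show ?thesis .
  qed
qed

text \<open>
  A lower bound for the expected final number of suppliers with a customer, when there are \<open>y\<close> of them
  and \<open>k\<close> customers are left. If \<open>X\<close> is \<open>y\<close> plus a binomial variable with parameters \<open>k\<close> and \<open>1 / n\<close>, that
  expectation is the one of \<open>min n X\<close>, and \<open>min n X \<ge> n - ((X - n)\<^sup>2 / m + m) / 2\<close>. The second
  moment of \<open>X - n\<close> is the numerator below. For \<open>y = 0\<close> and \<open>k = n\<^sup>2\<close> the mean of \<open>X\<close> is exactly \<open>n\<close>.
\<close>

definition potential :: "real \<Rightarrow> real \<Rightarrow> real" where
  "potential y k = n - ((y + k / n - n)\<^sup>2 + k / n * (1 - 1 / n)) / (2 * m) - m / 2"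

lemma potential_step:
  "potential y k = potential y (k - 1) + 1 / n * (potential (y + 1) (k - 1) - potential y (k - 1))"
proof -
  define p :: real where "p = 1 / n"
  define W where "W y k = ((y + k * p - n)\<^sup>2 + k * p * (1 - p)) / (2 * m)" for y k :: real
  have "(y + k * p - n)\<^sup>2 + k * p * (1 - p) =
      (1 - p) * ((y + (k - 1) * p - n)\<^sup>2 + (k - 1) * p * (1 - p)) +
      p * ((y + 1 + (k - 1) * p - n)\<^sup>2 + (k - 1) * p * (1 - p))"
    by (simp add: power2_eq_square algebra_simps)
  then have W: "W y k = (1 - p) * W y (k - 1) + p * W (y + 1) (k - 1)"
    by (simp add: W_def add_divide_distrib[symmetric])
  have potential: "potential y k = n - W y k - m / 2" for y k
    by (simp add: potential_def p_def W_def)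
  show ?thesis
    unfolding p_def[symmetric] potential W by (simp add: algebra_simps)
qed

text \<open>
  Once every supplier has a customer, further customers are wasted, and the potential must not decrease
  when they are processed.
\<close>

lemma potential_saturated: "1 \<le> k \<Longrightarrow> potential n k \<le> potential n (k - 1)"
proof -
  assume k: "1 \<le> k"
  have "(k - 1) / n \<le> k / n" by (simp add: divide_right_mono)
  moreover have "((k - 1) / n)\<^sup>2 \<le> (k / n)\<^sup>2"
    using k by (intro power_mono divide_right_mono) auto
  moreover have "(k - 1) / n * (1 - 1 / n) \<le> k / n * (1 - 1 / n)"
    using n_ge by (intro mult_right_mono divide_right_mono) auto
  ultimately have "((k - 1) / n)\<^sup>2 + (k - 1) / n * (1 - 1 / n) \<le> (k / n)\<^sup>2 + k / n * (1 - 1 / n)" by simp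
  then show ?thesis unfolding potential_def by (simp add: divide_right_mono)
qed

lemma potential_final: "potential y 0 \<le> y"
proof -
  have "2 * m * (n - y) \<le> (n - y)\<^sup>2 + m\<^sup>2"
    using sum_squares_bound[of "m" "n - y"] by (simp add: algebra_simps)
  then have "n - y \<le> ((n - y)\<^sup>2 + m\<^sup>2) / (2 * m)"
    using m by (simp add: field_simps)
  also have "\<dots> = (y - n)\<^sup>2 / (2 * m) + m / 2"
    using m power2_commute[of "real n" y] by (simp add: add_divide_distrib power2_eq_square[of "real m"])
  finally show "potential y 0 \<le> y" by (simp add: potential_def)
qed

lemma potential_initial: "real n - m \<le> potential 0 (n\<^sup>2)"
proof -
  have n: "real n = real m * real m" by (simp add: n_eq power2_eq_square)
  have "real (n\<^sup>2) / n = n" using n_ge by (simp add: power2_eq_square)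
  then have "potential 0 (n\<^sup>2) = n - (n * (1 - 1 / n)) / (2 * m) - m / 2"
    by (simp add: potential_def)
  moreover have "n * (1 - 1 / n :: real) / (2 * m) \<le> n / (2 * m)"
    using n_ge by (intro divide_right_mono) (auto simp: right_diff_distrib)
  moreover have "real n / (2 * m) = m / 2"
    using m unfolding n by simp
  ultimately show ?thesis by linarith
qed

text \<open>
  Always offer a supplier that nobody has chosen so far. The number \<open>Y\<close> of suppliers with a customer then
  grows by one with probability \<open>1 / n\<close> for each customer, as long as it is below \<open>n\<close>, and the potential
  of the current state is a submartingale.
\<close>

lemma le_OPT_OA: "real n - m \<le> OPT_OA w I"
proof -
  interpret two_sides I C S using valid regular by unfold_locales auto
  define idle where "idle h j \<longleftrightarrow> j \<in> S \<and> backlog h j = {}" for h j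
  define A where "A h = (if \<exists>j. idle h j then {SOME j. idle h j} else {})" for h
  let ?\<kappa> = "cap w I C"
  let ?\<pi> = "two_phase ?\<kappa> (one_by_one A)"
  let ?E = "measure_pmf.expectation (run I ?\<pi> (card (agents I)))"
  have idle: "idle h (SOME j. idle h j)" if "\<exists>j. idle h j" for h using that by (rule someI_ex)
  have init: "initiating ?\<kappa> (one_by_one A)"
    using idle cap_I(2)
    by (intro one_by_one_initiating) (auto simp: A_def idle_def one_enat_def zero_enat_def)
  note adm = two_phase_admissible[OF init]
  define Y where "Y h = card {j\<in>S. backlog h j \<noteq> {}}" for h
  define F where "F h = potential (Y h) (card (C - processed h))" for h
  have "F [] \<le> ?E F"
  proof (rule run_submartingale[OF adm])
    fix h x assume p: "possible I ?\<pi> h x"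
    show "F h \<le> measure_pmf.expectation (choices I x) (\<lambda>ch. F (h @ [(x, ch)]))"
    proof (cases "C \<subseteq> processed h")
      case True
      then have "dom x \<inter> C = {}" using possible_action(2)[OF adm p] by auto
      then have "backlog (h @ [(x, ch)]) j = backlog h j" "C - processed (h @ [(x, ch)]) = C - processed h" for ch j
        by (auto simp: backlog_def)
      then have "F (h @ [(x, ch)]) = F h" for ch by (simp add: F_def Y_def)
      then show ?thesis by simp
    next
      case False
      define i where "i = (SOME i. i \<in> C - processed h)"
      have i: "i \<in> C" "i \<notin> processed h"
        using one_by_one_next[OF False] by (auto simp: i_def)
      have x: "x = [i \<mapsto> A h]"
        using p False by (simp add: possible_def two_phase_def one_by_one_def i_def)
      have rest: "C - processed (h @ [(x, ch)]) = (C - processed h) - {i}" for ch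
        by (auto simp: x)
      define k where "k = card (C - processed h)"
      have k: "k \<ge> 1" "card (C - processed h - {i}) = k - 1"
        using i fin by (auto simp: k_def Suc_le_eq card_gt_0_iff)
      have backlog': "backlog (h @ [(x, ch)]) j = (if ch i = Some j then insert i (backlog h j) else backlog h j)" for ch j
        using i by (auto simp: backlog_def x)
      show ?thesis
      proof (cases "\<exists>j. idle h j")
        case True
        define j where "j = (SOME j. idle h j)"
        have j: "j \<in> S" "backlog h j = {}" using idle[OF True] by (auto simp: j_def idle_def)
        have Ah: "A h = {j}" using True by (simp add: A_def j_def)
        have "F (h @ [(x, ch)]) = potential (Y h) (k - 1) +
            (potential (Y h + 1) (k - 1) - potential (Y h) (k - 1)) * of_bool (ch i = Some j)"
          if ch: "ch \<in> set_pmf (choices I x)" for ch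
        proof -
          have "ch i \<in> set_pmf (uniform_pick (q i) {j})"
            using ch by (auto simp: choices_def x set_Pi_pmf PiE_dflt_def Ah)
          then have "ch i = None \<or> ch i = Some j" using set_pmf_uniform_pick by fastforce
          then show ?thesis
          proof
            assume "ch i = None"
            then have "Y (h @ [(x, ch)]) = Y h" by (simp add: Y_def backlog')
            then show ?thesis using \<open>ch i = None\<close> k by (simp only: F_def rest) simp
          next
            assume ch: "ch i = Some j"
            then have "{j'\<in>S. backlog (h @ [(x, ch)]) j' \<noteq> {}} = insert j {j'\<in>S. backlog h j' \<noteq> {}}"
              using j by (auto simp: backlog')
            then have "Y (h @ [(x, ch)]) = Suc (Y h)" using j fin by (simp add: Y_def)
            then show ?thesis using ch k by (simp only: F_def rest) (simp add: add.commute)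
          qed
        qed
        then have "measure_pmf.expectation (choices I x) (\<lambda>ch. F (h @ [(x, ch)])) =
            measure_pmf.expectation (choices I x) (\<lambda>ch. potential (Y h) (k - 1) +
            (potential (Y h + 1) (k - 1) - potential (Y h) (k - 1)) * of_bool (ch i = Some j))"
          by (intro integral_cong_AE) (auto intro: AE_pmfI)
        also have "\<dots> = potential (Y h) (k - 1) + (potential (Y h + 1) (k - 1) - potential (Y h) (k - 1)) *
            measure_pmf.expectation (choices I x) (\<lambda>ch. of_bool (ch i = Some j))"
          by (simp add: integrable_measure_pmf_finite[OF finite_choices[OF adm p]])
        also have "measure_pmf.expectation (choices I x) (\<lambda>ch. of_bool (ch i = Some j)) =
            pmf (Choice I i {j}) (Some j)"
          using expectation_choices[OF adm p, of i "\<lambda>y. of_bool (y = Some j)"] expectation_single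
          by (simp add: x Ah)
        also have "\<dots> = 1 / n"
          using i q by (simp add: pmf_uniform_pick) (simp add: q_def)
        finally show ?thesis
          using potential_step[of "Y h" k] k(1) by (simp add: F_def k_def mult.commute add.commute of_nat_diff)
      next
        case False
        then have full: "backlog h j \<noteq> {}" if "j \<in> S" for j using that by (auto simp: idle_def)
        then have "{j\<in>S. backlog h j \<noteq> {}} = S" by auto
        then have Yh: "Y h = n" by (simp add: Y_def card_S)
        have "{j\<in>S. backlog (h @ [(x, ch)]) j \<noteq> {}} = S" for ch
          using full by (auto simp: backlog')
        then have "Y (h @ [(x, ch)]) = n" for ch by (simp add: Y_def card_S)
        then have "F (h @ [(x, ch)]) = potential n (k - 1)" for ch
          using k(2) by (simp only: F_def rest)
        then have "F h \<le> F (h @ [(x, ch)])" for ch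
          using potential_saturated[of k] k(1) Yh by (simp add: F_def k_def of_nat_diff)
        then have "measure_pmf.expectation (choices I x) (\<lambda>ch. F h) \<le>
           measure_pmf.expectation (choices I x) (\<lambda>ch. F (h @ [(x, ch)]))"
          by (intro integral_mono_AE integrable_measure_pmf_finite finite_choices[OF adm p] AE_pmfI)
        then show ?thesis by simp
      qed
    qed
  qed
  also have "?E F \<le> ?E (\<lambda>h. real (Y h))"
  proof (intro integral_mono_AE integrable_run[OF adm] AE_pmfI)
    fix h assume "h \<in> set_pmf (run I ?\<pi> (card (agents I)))"
    then have "C \<subseteq> processed h" using run_finished[OF adm] agents by auto
    then have "card (C - processed h) = 0" by (metis Diff_eq_empty_iff card.empty)
    then show "F h \<le> real (Y h)" using potential_final[of "Y h"] by (simp only: F_def of_nat_0)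
  qed
  also have "?E (\<lambda>h. real (Y h)) = ?E (\<lambda>h. \<Sum>j\<in>S. best_value ?\<kappa> j (backlog h j))"
  proof (intro Bochner_Integration.integral_cong refl)
    fix h
    have "best_value ?\<kappa> j (backlog h j) = of_bool (backlog h j \<noteq> {})" if "j \<in> S" for j
      using cap_I(1) disj that by (simp add: capped_demand_I) (auto simp: q_def)
    then show "real (Y h) = (\<Sum>j\<in>S. best_value ?\<kappa> j (backlog h j))"
      using fin(2) by (simp add: Y_def Int_def)
  qed
  also have "\<dots> = (\<Sum>j\<in>S. ?E (\<lambda>h. best_value ?\<kappa> j (backlog h j)))"
    by (intro Bochner_Integration.integral_sum integrable_run[OF adm])
  also have "\<dots> \<le> expected_matches I ?\<pi>" by (rule two_phase_value[OF init])
  also have "\<dots> \<le> OPT_OA w I"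
    by (rule OPT_OA_upper[OF valid _ adm one_by_one_adaptive]) simp
  finally have "F [] \<le> OPT_OA w I" .
  moreover have "F [] = potential 0 (n\<^sup>2)" by (simp add: F_def Y_def backlog_def card_C)
  ultimately show ?thesis using potential_initial by simp
qed

end

lemma gap_instance_exists:
  fixes m :: nat
  assumes "m \<ge> 2"
  obtains I :: "'a::infinite market" where "valid_market I" "regular I"
    "\<And>w. real (m\<^sup>2) - m \<le> OPT_OA w I"
    "\<And>w. OPT_OS w I \<le> m\<^sup>2 * (1 - (1 - 1 / m\<^sup>2) ^ m\<^sup>2)"
proof -
  obtain C :: "'a set" where C: "finite C" "card C = (m\<^sup>2)\<^sup>2"
    using infinite_arbitrarily_large[OF infinite_UNIV] by blast
  have "infinite (UNIV - C)" using C(1) infinite_UNIV by (simp add: Diff_infinite_finite)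
  then obtain S where S: "finite S" "card S = m\<^sup>2" "S \<subseteq> UNIV - C"
    using infinite_arbitrarily_large by blast
  interpret gap_instance C S m "m\<^sup>2" using assms C S by unfold_locales auto
  show ?thesis using that[OF valid regular le_OPT_OA] OPT_OS_le by simp
qed

lemma gap_ratio_tendsto:
  "(\<lambda>m :: nat. (real (m\<^sup>2) - m) / (m\<^sup>2 * (1 - (1 - 1 / m\<^sup>2) ^ m\<^sup>2))) \<longlonglongrightarrow> exp 1 / (exp 1 - 1)"
proof -
  have limit: "exp 1 / (exp 1 - 1) = inverse (1 - exp (- 1) :: real)"
    using one_sided_ratio by (simp add: inverse_eq_divide)
  have "(\<lambda>m :: nat. (real m^2 - m) / (real m^2 * (1 - (1 - 1 / real m^2) powr (real m^2))))
      \<longlonglongrightarrow> inverse (1 - exp (- 1))"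
    by real_asymp
  also have "?this \<longleftrightarrow> ?thesis"
    unfolding limit
  proof (rule tendsto_cong, rule eventually_sequentiallyI[of 2])
    fix m :: nat assume "2 \<le> m"
    then have "1 < real m ^ 2" by (simp add: one_less_power)
    then have "0 < 1 - 1 / real m ^ 2" by (simp add: divide_less_eq)
    then have "(1 - 1 / real m ^ 2) powr real (m\<^sup>2) = (1 - 1 / real m ^ 2) ^ m\<^sup>2"
      by (rule powr_realpow)
    then show "(real m^2 - m) / (real m^2 * (1 - (1 - 1 / real m^2) powr (real m^2))) =
       (real (m\<^sup>2) - m) / (m\<^sup>2 * (1 - (1 - 1 / m\<^sup>2) ^ m\<^sup>2))"
      by simp
  qed
  finally show ?thesis .
qed

section \<open>The adaptivity gap\<close>

text \<open>
  The instances count for the supremum only if their static optimum is positive. This follows from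
  the positive adaptive optimum by any upper bound \<open>c\<close> on the gap.
\<close>

lemma adaptivity_gap_ge:
  assumes upper: "\<And>I :: 'a::infinite market. valid_market I \<Longrightarrow> regular I \<Longrightarrow> OPT_OA w I \<le> c * OPT_OS w I"
    and c: "c > 0"
  shows "ereal (exp 1 / (exp 1 - 1)) \<le> adaptivity_gap w {I :: 'a market. valid_market I \<and> regular I}"
proof -
  let ?ratio = "\<lambda>m :: nat. (real (m\<^sup>2) - m) / (m\<^sup>2 * (1 - (1 - 1 / m\<^sup>2) ^ m\<^sup>2))"
  let ?gap = "adaptivity_gap w {I :: 'a market. valid_market I \<and> regular I}"
  have ratio_le: "ereal (?ratio m) \<le> ?gap" if m: "2 \<le> m" for m
  proof -
    obtain I :: "'a market" where I: "valid_market I" "regular I"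
      and OA: "real (m\<^sup>2) - m \<le> OPT_OA w I"
      and OS: "OPT_OS w I \<le> m\<^sup>2 * (1 - (1 - 1 / m\<^sup>2) ^ m\<^sup>2)"
      using gap_instance_exists[OF m] by metis
    have "0 < real (m\<^sup>2) - m" using m by (simp add: power2_eq_square)
    then have pos: "0 < OPT_OA w I" using OA by linarith
    then have "0 < c * OPT_OS w I" using upper[OF I] by linarith
    then have OS_pos: "0 < OPT_OS w I" using c by (simp add: zero_less_mult_iff)
    have "?ratio m \<le> OPT_OA w I / OPT_OS w I"
      using OA OS OS_pos pos by (intro frac_le) auto
    then have "ereal (?ratio m) \<le> ereal (OPT_OA w I / OPT_OS w I)" by simp
    also have "ereal (OPT_OA w I / OPT_OS w I) \<le> ?gap"
    proof -
      have "I \<in> {I \<in> {I. valid_market I \<and> regular I}. 0 < OPT_OS w I}" using I OS_pos by simp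
      then show ?thesis unfolding adaptivity_gap_def by (rule SUP_upper)
    qed
    finally show ?thesis .
  qed
  show ?thesis
  proof (rule LIMSEQ_le_const2)
    show "(\<lambda>m. ereal (?ratio m)) \<longlonglongrightarrow> ereal (exp 1 / (exp 1 - 1))"
      using gap_ratio_tendsto by simp
    show "\<exists>N. \<forall>m\<ge>N. ereal (?ratio m) \<le> ?gap" using ratio_le by blast
  qed
qed

theorem theorem6p1:
  shows
    "(ereal (exp 1 / (exp 1 - 1))
        \<le> adaptivity_gap Two_Way {I :: 'a::infinite market. valid_market I \<and> regular I} \<and>
      adaptivity_gap Two_Way {I :: 'a market. valid_market I \<and> regular I}
        \<le> ereal ((exp 1 / (exp 1 - 1))\<^sup>2)) \<and>
     (adaptivity_gap Two_Way {I :: 'a market. valid_market I \<and> mnl I}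
        \<le> ereal (exp 1 / (exp 1 - 1)) \<and>
      (\<forall>I :: 'a market. valid_market I \<and> mnl I \<longrightarrow>
         OPT_OA Two_Way I \<le> exp 1 / (exp 1 - 1) * OPT_OS Two_Way I)) \<and>
     adaptivity_gap One_Way {I :: 'a market. valid_market I \<and> regular I}
       = ereal (exp 1 / (exp 1 - 1))"
proof (intro conjI allI impI)
  show "ereal (exp 1 / (exp 1 - 1)) \<le> adaptivity_gap Two_Way {I :: 'a market. valid_market I \<and> regular I}"
    by (rule adaptivity_gap_ge[OF OPT_OA_le_two_way]) simp_all
  have "adaptivity_gap Two_Way {I :: 'a market. valid_market I \<and> regular I} \<le> ereal (2 / (1 - exp (- 2)))"
    by (rule adaptivity_gap_le) (use OPT_OA_le_two_way in auto)
  also have "\<dots> \<le> ereal ((exp 1 / (exp 1 - 1))\<^sup>2)" using two_way_ratio by simp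
  finally show "adaptivity_gap Two_Way {I :: 'a market. valid_market I \<and> regular I}
        \<le> ereal ((exp 1 / (exp 1 - 1))\<^sup>2)" .
  show "adaptivity_gap Two_Way {I :: 'a market. valid_market I \<and> mnl I} \<le> ereal (exp 1 / (exp 1 - 1))"
    by (rule adaptivity_gap_le) (use OPT_OA_le_mnl in auto)
  show "OPT_OA Two_Way I \<le> exp 1 / (exp 1 - 1) * OPT_OS Two_Way I" if "valid_market I \<and> mnl I" for I :: "'a market"
    using OPT_OA_le_mnl that by blast
  show "adaptivity_gap One_Way {I :: 'a market. valid_market I \<and> regular I} = ereal (exp 1 / (exp 1 - 1))"
  proof (rule antisym)
    show "adaptivity_gap One_Way {I :: 'a market. valid_market I \<and> regular I} \<le> ereal (exp 1 / (exp 1 - 1))"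
      by (rule adaptivity_gap_le) (use OPT_OA_le_one_way in auto)
    show "ereal (exp 1 / (exp 1 - 1)) \<le> adaptivity_gap One_Way {I :: 'a market. valid_market I \<and> regular I}"
      by (rule adaptivity_gap_ge[OF OPT_OA_le_one_way]) simp_all
  qed
qed

end
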